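(* Let $f:[0,\infty)\times\mathbb{R}\to\mathbb{R}$, $(t,v)\mapsto f(t,v)$, be a continuous function, locally Lipschitz in $v$, and such that for all $t\ge0$, $x\le y$ implies $f(t,x)\le f(t,y)$. Let $0<\gamma<1$. (a) Suppose $v_1(t)$ is continuous and satisfies $$D_c^\gamma v_1(t)\le f(t,v_1(t)),$$ where this inequality means that $D_c^\gamma v_1-f(\cdot,v_1(\cdot))$ is a nonpositive distribution. Suppose also that $v_2$ is the continuous solution of $$D_c^\gamma v_2(t)=f(t,v_2(t)),\qquad v_2(0)\ge v_1(0).$$ Then $v_1\le v_2$ on their common interval of existence. (b) Correspondingly, if $v_1$ is continuous and satisfies $D_c^\gamma v_1(t)\ge f(t,v_1(t))$ in the same sense (that is, $f(\cdot,v_1(\cdot))-D_c^\gamma v_1$ is a nonpositive distribution), and $v_2$ is the continuous solution of $D_c^\gamma v_2(t)=f(t,v_2(t))$ with $v_2(0)\le v_1(0)$, then $v_1\ge v_2$ on their common interval of existence.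
   Context: Functions on an interval $[0,T)$, $T\in(0,\infty]$, are identified with distributions in $\mathscr D'(-\infty,T)$ by extension by zero to $t<0$ (in particular $f(\cdot,v_1(\cdot))$ is set to $0$ for $t<0$). $\theta$ is the Heaviside function and $g_\alpha(t)=\theta(t)t^{\alpha-1}/\Gamma(\alpha)$ for $\alpha>0$. For a continuous function $\varphi$ on $[0,T)$, the Caputo derivative of order $\gamma\in(0,1)$ is the distribution $D_c^\gamma\varphi:=J_{-\gamma}\varphi-\varphi(0)g_{1-\gamma}\in\mathscr D'(-\infty,T)$, where $J_{-\gamma}\varphi$ is the distributional derivative on $(-\infty,T)$ of the function equal to $\frac{1}{\Gamma(1-\gamma)}\int_0^t(t-s)^{-\gamma}\varphi(s)\,ds$ for $0<t<T$ and to $0$ for $t<0$. A continuous solution on $[0,T)$ is a continuous function satisfying the equation in $\mathscr D'(-\infty,T)$. A distribution $h\in\mathscr D'(-\infty,T)$ is nonpositive if $\langle h,\varphi\rangle\le0$ for all $\varphi\in C_c^\infty(-\infty,T)$ with $\varphi\ge0$. *)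

theory Defs
  imports "HOL-Analysis.Analysis"
begin

text \<open>
  A distribution on \<open>(-\<infinity>, T)\<close> is represented by its action on test functions. Only the values
  on \<open>test_functions T\<close> matter, so equality in \<open>D'(-\<infinity>, T)\<close> is \<open>dist_eq T\<close>, not \<open>(=)\<close>.
\<close>

definition test_functions :: "ereal \<Rightarrow> (real \<Rightarrow> real) set" where
  "test_functions T = {\<phi>. (\<forall>k x. (deriv ^^ k) \<phi> differentiable (at x))
      \<and> compact (closure {t. \<phi> t \<noteq> 0}) \<and> closure {t. \<phi> t \<noteq> 0} \<subseteq> {t. ereal t < T}}"

text \<open>
  Continuity is expressed by the usual seminorm estimate on each compact set: \<open>B\<close> ranges over
  the bounds for \<open>sup |\<phi>^(k)|\<close>, \<open>k \<le> N\<close>.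
\<close>

definition distributions :: "ereal \<Rightarrow> ((real \<Rightarrow> real) \<Rightarrow> real) set" where
  "distributions T = {h.
      (\<forall>\<phi>\<in>test_functions T. \<forall>\<psi>\<in>test_functions T. h (\<lambda>t. \<phi> t + \<psi> t) = h \<phi> + h \<psi>)
    \<and> (\<forall>c. \<forall>\<phi>\<in>test_functions T. h (\<lambda>t. c * \<phi> t) = c * h \<phi>)
    \<and> (\<forall>K. compact K \<longrightarrow> K \<subseteq> {t. ereal t < T} \<longrightarrow>
         (\<exists>C N. \<forall>\<phi>\<in>test_functions T. closure {t. \<phi> t \<noteq> 0} \<subseteq> K \<longrightarrow>
            (\<forall>B. (\<forall>k\<le>N. \<forall>x. \<bar>(deriv ^^ k) \<phi> x\<bar> \<le> B) \<longrightarrow> \<bar>h \<phi>\<bar> \<le> C * B)))}"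

definition dist_eq :: "ereal \<Rightarrow> ((real \<Rightarrow> real) \<Rightarrow> real) \<Rightarrow> ((real \<Rightarrow> real) \<Rightarrow> real) \<Rightarrow> bool" where
  "dist_eq T h k \<longleftrightarrow> h \<in> distributions T \<and> k \<in> distributions T
      \<and> (\<forall>\<phi>\<in>test_functions T. h \<phi> = k \<phi>)"

definition nonpositive_dist :: "ereal \<Rightarrow> ((real \<Rightarrow> real) \<Rightarrow> real) \<Rightarrow> bool" where
  "nonpositive_dist T h \<longleftrightarrow> h \<in> distributions T
      \<and> (\<forall>\<phi>\<in>test_functions T. (\<forall>t. 0 \<le> \<phi> t) \<longrightarrow> h \<phi> \<le> 0)"

definition regular_dist :: "(real \<Rightarrow> real) \<Rightarrow> (real \<Rightarrow> real) \<Rightarrow> real" where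
  "regular_dist u = (\<lambda>\<phi>. LBINT t. u t * \<phi> t)"

definition dist_deriv :: "((real \<Rightarrow> real) \<Rightarrow> real) \<Rightarrow> (real \<Rightarrow> real) \<Rightarrow> real" where
  "dist_deriv h = (\<lambda>\<phi>. - h (deriv \<phi>))"

definition dist_minus ::
    "((real \<Rightarrow> real) \<Rightarrow> real) \<Rightarrow> ((real \<Rightarrow> real) \<Rightarrow> real) \<Rightarrow> (real \<Rightarrow> real) \<Rightarrow> real" where
  "dist_minus h k = (\<lambda>\<phi>. h \<phi> - k \<phi>)"

definition time_interval :: "ereal \<Rightarrow> real set" where
  "time_interval T = {t. 0 \<le> t \<and> ereal t < T}"

text \<open>
  Extension by zero of a function on \<open>[0, T)\<close>; its values beyond \<open>T\<close> are irrelevant on \<open>(-\<infinity>, T)\<close>.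
\<close>

definition zero_ext :: "ereal \<Rightarrow> (real \<Rightarrow> real) \<Rightarrow> real \<Rightarrow> real" where
  "zero_ext T u t = (if t \<in> time_interval T then u t else 0)"

definition g_kernel :: "real \<Rightarrow> real \<Rightarrow> real" where
  "g_kernel \<alpha> t = (if t > 0 then t powr (\<alpha> - 1) / Gamma \<alpha> else 0)"

text \<open>
  \<open>J_(-\<gamma>) v\<close>. The integrand takes the value 0 at \<open>s = t\<close> because \<open>0 powr a = 0\<close>; this is a null set.
\<close>

definition frac_deriv :: "real \<Rightarrow> ereal \<Rightarrow> (real \<Rightarrow> real) \<Rightarrow> (real \<Rightarrow> real) \<Rightarrow> real" where
  "frac_deriv \<gamma> T v = dist_deriv (regular_dist (zero_ext T
      (\<lambda>t. 1 / Gamma (1 - \<gamma>) * (LBINT s:{0..t}. (t - s) powr (-\<gamma>) * v s))))"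

definition caputo_deriv :: "real \<Rightarrow> ereal \<Rightarrow> (real \<Rightarrow> real) \<Rightarrow> (real \<Rightarrow> real) \<Rightarrow> real" where
  "caputo_deriv \<gamma> T v =
     dist_minus (frac_deriv \<gamma> T v) (regular_dist (\<lambda>t. v 0 * g_kernel (1 - \<gamma>) t))"

definition rhs_dist :: "(real \<Rightarrow> real \<Rightarrow> real) \<Rightarrow> ereal \<Rightarrow> (real \<Rightarrow> real) \<Rightarrow> (real \<Rightarrow> real) \<Rightarrow> real" where
  "rhs_dist f T v = regular_dist (zero_ext T (\<lambda>t. f t (v t)))"

definition continuous_solution ::
    "(real \<Rightarrow> real \<Rightarrow> real) \<Rightarrow> real \<Rightarrow> ereal \<Rightarrow> (real \<Rightarrow> real) \<Rightarrow> bool" where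
  "continuous_solution f \<gamma> T v \<longleftrightarrow>
     continuous_on (time_interval T) v \<and> dist_eq T (caputo_deriv \<gamma> T v) (rhs_dist f T v)"


text \<open>
  The rest of this theory checks that the functionals above really belong to \<open>D'(-\<infinity>, T)\<close>
  for continuous data, so that the membership conditions in \<open>dist_eq\<close> and \<open>nonpositive_dist\<close>
  restrict nothing.
\<close>

definition locally_integrable :: "ereal \<Rightarrow> (real \<Rightarrow> real) \<Rightarrow> bool" where
  "locally_integrable T u \<longleftrightarrow>
     (\<forall>K. compact K \<longrightarrow> K \<subseteq> {t. ereal t < T} \<longrightarrow> set_integrable lborel K u)"

lemma distributionsI:
  assumes "\<And>\<phi> \<psi>. \<phi> \<in> test_functions T \<Longrightarrow> \<psi> \<in> test_functions T \<Longrightarrow>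
      h (\<lambda>t. \<phi> t + \<psi> t) = h \<phi> + h \<psi>"
    and "\<And>c \<phi>. \<phi> \<in> test_functions T \<Longrightarrow> h (\<lambda>t. c * \<phi> t) = c * h \<phi>"
    and "\<And>K. compact K \<Longrightarrow> K \<subseteq> {t. ereal t < T} \<Longrightarrow>
      \<exists>C N. \<forall>\<phi>\<in>test_functions T. closure {t. \<phi> t \<noteq> 0} \<subseteq> K \<longrightarrow>
         (\<forall>B. (\<forall>k\<le>N. \<forall>x. \<bar>(deriv ^^ k) \<phi> x\<bar> \<le> B) \<longrightarrow> \<bar>h \<phi>\<bar> \<le> C * B)"
  shows "h \<in> distributions T"
  unfolding distributions_def mem_Collect_eq
  by (intro conjI ballI allI impI) (fact assms)+

lemma distributions_add:
  "h \<in> distributions T \<Longrightarrow> \<phi> \<in> test_functions T \<Longrightarrow> \<psi> \<in> test_functions T \<Longrightarrow>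
    h (\<lambda>t. \<phi> t + \<psi> t) = h \<phi> + h \<psi>"
  by (simp add: distributions_def)

lemma distributions_scale:
  "h \<in> distributions T \<Longrightarrow> \<phi> \<in> test_functions T \<Longrightarrow> h (\<lambda>t. c * \<phi> t) = c * h \<phi>"
  by (simp add: distributions_def)

lemma distributions_bound:
  assumes "h \<in> distributions T" "compact K" "K \<subseteq> {t. ereal t < T}"
  shows "\<exists>C N. \<forall>\<phi>\<in>test_functions T. closure {t. \<phi> t \<noteq> 0} \<subseteq> K \<longrightarrow>
      (\<forall>B. (\<forall>k\<le>N. \<forall>x. \<bar>(deriv ^^ k) \<phi> x\<bar> \<le> B) \<longrightarrow> \<bar>h \<phi>\<bar> \<le> C * B)"
  using assms by (simp add: distributions_def)

lemma test_functions_deriv: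
  assumes "\<phi> \<in> test_functions T"
  shows "deriv \<phi> \<in> test_functions T"
    and "closure {t. deriv \<phi> t \<noteq> 0} \<subseteq> closure {t. \<phi> t \<noteq> 0}"
proof -
  let ?S = "closure {t. \<phi> t \<noteq> 0}"
  have z: "deriv \<phi> x = 0" if "x \<notin> ?S" for x
  proof -
    have "eventually (\<lambda>t. t \<in> - ?S) (nhds x)"
      using that by (intro eventually_nhds_in_open) auto
    then have "eventually (\<lambda>t. \<phi> t = 0) (nhds x)"
      by (rule eventually_mono) (use closure_subset[of "{t. \<phi> t \<noteq> 0}"] in auto)
    then have "deriv \<phi> x = deriv (\<lambda>_. 0) x"
      by (rule deriv_cong_ev) simp
    then show ?thesis by simp
  qed
  then have "{t. deriv \<phi> t \<noteq> 0} \<subseteq> ?S" by auto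
  then show sub: "closure {t. deriv \<phi> t \<noteq> 0} \<subseteq> ?S"
    by (rule closure_minimal) simp
  have c: "compact ?S" and s: "?S \<subseteq> {t. ereal t < T}"
    and d: "\<And>k x. (deriv ^^ k) \<phi> differentiable (at x)"
    using assms by (auto simp: test_functions_def)
  have "(deriv ^^ k) (deriv \<phi>) differentiable (at x)" for k x
    using d[of "Suc k" x] by (simp add: funpow_Suc_right del: funpow.simps)
  moreover have "compact (closure {t. deriv \<phi> t \<noteq> 0})"
    using bounded_subset[OF compact_imp_bounded[OF c] sub] by (simp add: compact_eq_bounded_closed)
  ultimately show "deriv \<phi> \<in> test_functions T"
    using sub s by (auto simp: test_functions_def)
qed

lemma test_functions_differentiable:
  assumes "\<phi> \<in> test_functions T"
  shows "\<phi> field_differentiable (at x)"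
proof -
  have "\<forall>k x. (deriv ^^ k) \<phi> differentiable (at x)"
    using assms unfolding test_functions_def by blast
  from this[rule_format, of 0 x] have "\<phi> differentiable (at x)"
    by simp
  then show ?thesis
    by (auto simp: real_differentiable_def field_differentiable_def)
qed

lemma test_functions_continuous: "\<phi> \<in> test_functions T \<Longrightarrow> continuous_on UNIV \<phi>"
  by (intro continuous_at_imp_continuous_on ballI field_differentiable_imp_continuous_at
      test_functions_differentiable)

lemma regular_dist_integrable:
  assumes u: "locally_integrable T u" and \<phi>: "\<phi> \<in> test_functions T"
  shows "integrable lborel (\<lambda>t. u t * \<phi> t)"
proof -
  let ?S = "closure {t. \<phi> t \<noteq> 0}"
  have S: "compact ?S" "?S \<subseteq> {t. ereal t < T}"
    using \<phi> by (auto simp: test_functions_def)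
  have i: "integrable lborel (\<lambda>t. indicator ?S t *\<^sub>R u t)"
    using u S unfolding locally_integrable_def set_integrable_def by blast
  have "compact (\<phi> ` ?S)"
    using S(1) test_functions_continuous[OF \<phi>]
    by (meson compact_continuous_image continuous_on_subset subset_UNIV)
  then obtain B where B: "\<And>t. t \<in> ?S \<Longrightarrow> \<bar>\<phi> t\<bar> \<le> B"
    using compact_imp_bounded bounded_iff by (metis imageI real_norm_def)
  have e: "u t * \<phi> t = (indicator ?S t *\<^sub>R u t) * \<phi> t" for t
    using closure_subset[of "{t. \<phi> t \<noteq> 0}"] by (auto simp: indicator_def)
  have m: "\<phi> \<in> borel_measurable lborel"
    using borel_measurable_continuous_onI[OF test_functions_continuous[OF \<phi>]] by simp
  have "integrable lborel (\<lambda>t. (indicator ?S t *\<^sub>R u t) * \<phi> t)"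
  proof (rule Bochner_Integration.integrable_bound[OF integrable_mult_left[OF i, of B]])
    show "(\<lambda>t. indicator ?S t *\<^sub>R u t * \<phi> t) \<in> borel_measurable lborel"
      using borel_measurable_integrable[OF i] m by (rule borel_measurable_times)
    show "AE t in lborel. norm (indicator ?S t *\<^sub>R u t * \<phi> t) \<le> norm (indicator ?S t *\<^sub>R u t * B)"
    proof (rule AE_I2)
      fix t
      show "norm (indicator ?S t *\<^sub>R u t * \<phi> t) \<le> norm (indicator ?S t *\<^sub>R u t * B)"
        using B[of t] by (cases "t \<in> ?S") (auto simp: abs_mult intro!: mult_left_mono)
    qed
  qed
  then show ?thesis by (simp only: e[symmetric])
qed

lemma regular_dist_in_distributions:
  assumes u: "locally_integrable T u"
  shows "regular_dist u \<in> distributions T"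
proof -
  have bound: "\<bar>regular_dist u \<phi>\<bar> \<le> (LBINT t. \<bar>indicator K t *\<^sub>R u t\<bar>) * B"
    if K: "compact K" "K \<subseteq> {t. ereal t < T}" and \<phi>: "\<phi> \<in> test_functions T"
      and s: "closure {t. \<phi> t \<noteq> 0} \<subseteq> K" and B: "\<And>x. \<bar>\<phi> x\<bar> \<le> B" for K \<phi> B
  proof -
    have i: "integrable lborel (\<lambda>t. indicator K t *\<^sub>R u t)"
      using u K unfolding locally_integrable_def set_integrable_def by blast
    have "norm (LBINT t. u t * \<phi> t) \<le> (LBINT t. \<bar>indicator K t *\<^sub>R u t\<bar> * B)"
    proof (rule Bochner_Integration.integral_norm_bound_integral)
      show "integrable lborel (\<lambda>t. u t * \<phi> t)"
        by (rule regular_dist_integrable[OF u \<phi>])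
      show "integrable lborel (\<lambda>t. \<bar>indicator K t *\<^sub>R u t\<bar> * B)"
        using integrable_abs[OF i] by (rule integrable_mult_left)
      fix t
      show "norm (u t * \<phi> t) \<le> \<bar>indicator K t *\<^sub>R u t\<bar> * B"
      proof (cases "\<phi> t = 0")
        case True
        have "0 \<le> B" using B[of t] by linarith
        then show ?thesis using True by simp
      next
        case False
        then have "t \<in> K" using s closure_subset[of "{t. \<phi> t \<noteq> 0}"] by auto
        then show ?thesis using B[of t] by (auto simp: abs_mult intro!: mult_left_mono)
      qed
    qed
    then show ?thesis by (simp add: regular_dist_def)
  qed
  have "\<exists>C N. \<forall>\<phi>\<in>test_functions T. closure {t. \<phi> t \<noteq> 0} \<subseteq> K \<longrightarrow>
            (\<forall>B. (\<forall>k\<le>N. \<forall>x. \<bar>(deriv ^^ k) \<phi> x\<bar> \<le> B) \<longrightarrow> \<bar>regular_dist u \<phi>\<bar> \<le> C * B)"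
    if K: "compact K" "K \<subseteq> {t. ereal t < T}" for K
    by (rule exI[of _ "LBINT t. \<bar>indicator K t *\<^sub>R u t\<bar>"], rule exI[of _ 0])
       (use bound[OF K] in auto)
  moreover have "regular_dist u (\<lambda>t. \<phi> t + \<psi> t) = regular_dist u \<phi> + regular_dist u \<psi>"
    if "\<phi> \<in> test_functions T" "\<psi> \<in> test_functions T" for \<phi> \<psi>
    using regular_dist_integrable[OF u that(1)] regular_dist_integrable[OF u that(2)]
    by (simp add: regular_dist_def distrib_left)
  moreover have "regular_dist u (\<lambda>t. c * \<phi> t) = c * regular_dist u \<phi>" for c \<phi>
    by (simp add: regular_dist_def mult.left_commute)
  ultimately show ?thesis
    by (auto simp: distributions_def)
qed

lemma dist_deriv_in_distributions:
  assumes h: "h \<in> distributions T"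
  shows "dist_deriv h \<in> distributions T"
proof (rule distributionsI)
  fix K assume K: "compact K" "K \<subseteq> {t. ereal t < T}"
  obtain C N where CN: "\<forall>\<phi>\<in>test_functions T. closure {t. \<phi> t \<noteq> 0} \<subseteq> K \<longrightarrow>
      (\<forall>B. (\<forall>k\<le>N. \<forall>x. \<bar>(deriv ^^ k) \<phi> x\<bar> \<le> B) \<longrightarrow> \<bar>h \<phi>\<bar> \<le> C * B)"
    using distributions_bound[OF h K] by (elim exE)
  show "\<exists>C N. \<forall>\<phi>\<in>test_functions T. closure {t. \<phi> t \<noteq> 0} \<subseteq> K \<longrightarrow>
      (\<forall>B. (\<forall>k\<le>N. \<forall>x. \<bar>(deriv ^^ k) \<phi> x\<bar> \<le> B) \<longrightarrow> \<bar>dist_deriv h \<phi>\<bar> \<le> C * B)"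
  proof (rule exI[of _ C], rule exI[of _ "Suc N"], intro ballI allI impI)
    fix \<phi> B
    assume \<phi>: "\<phi> \<in> test_functions T" and s: "closure {t. \<phi> t \<noteq> 0} \<subseteq> K"
      and B: "\<forall>k\<le>Suc N. \<forall>x. \<bar>(deriv ^^ k) \<phi> x\<bar> \<le> B"
    have "\<bar>h (deriv \<phi>)\<bar> \<le> C * B"
    proof (rule CN[rule_format, OF test_functions_deriv(1)[OF \<phi>]
          order_trans[OF test_functions_deriv(2)[OF \<phi>] s]])
      fix k x assume "k \<le> N"
      then show "\<bar>(deriv ^^ k) (deriv \<phi>) x\<bar> \<le> B"
        using B[rule_format, of "Suc k" x]
        by (simp add: funpow_Suc_right del: funpow.simps)
    qed
    then show "\<bar>dist_deriv h \<phi>\<bar> \<le> C * B" by (simp add: dist_deriv_def)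
  qed
next
  fix \<phi> \<psi> assume t: "\<phi> \<in> test_functions T" "\<psi> \<in> test_functions T"
  have "deriv (\<lambda>t. \<phi> t + \<psi> t) = (\<lambda>t. deriv \<phi> t + deriv \<psi> t)"
    by (intro ext deriv_add test_functions_differentiable[OF t(1)]
        test_functions_differentiable[OF t(2)])
  then show "dist_deriv h (\<lambda>t. \<phi> t + \<psi> t) = dist_deriv h \<phi> + dist_deriv h \<psi>"
    using distributions_add[OF h t[THEN test_functions_deriv(1)]] by (simp add: dist_deriv_def)
next
  fix c \<phi> assume t: "\<phi> \<in> test_functions T"
  have "deriv (\<lambda>t. c * \<phi> t) = (\<lambda>t. c * deriv \<phi> t)"
    by (intro ext deriv_cmult test_functions_differentiable[OF t])
  then show "dist_deriv h (\<lambda>t. c * \<phi> t) = c * dist_deriv h \<phi>"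
    using distributions_scale[OF h test_functions_deriv(1)[OF t]] by (simp add: dist_deriv_def)
qed

lemma dist_minus_in_distributions:
  assumes h: "h \<in> distributions T" and k: "k \<in> distributions T"
  shows "dist_minus h k \<in> distributions T"
proof (rule distributionsI)
  fix K assume K: "compact K" "K \<subseteq> {t. ereal t < T}"
  obtain C N where CN: "\<forall>\<phi>\<in>test_functions T. closure {t. \<phi> t \<noteq> 0} \<subseteq> K \<longrightarrow>
      (\<forall>B. (\<forall>k\<le>N. \<forall>x. \<bar>(deriv ^^ k) \<phi> x\<bar> \<le> B) \<longrightarrow> \<bar>h \<phi>\<bar> \<le> C * B)"
    using distributions_bound[OF h K] by (elim exE)
  obtain C' N' where CN': "\<forall>\<phi>\<in>test_functions T. closure {t. \<phi> t \<noteq> 0} \<subseteq> K \<longrightarrow>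
      (\<forall>B. (\<forall>k\<le>N'. \<forall>x. \<bar>(deriv ^^ k) \<phi> x\<bar> \<le> B) \<longrightarrow> \<bar>k \<phi>\<bar> \<le> C' * B)"
    using distributions_bound[OF k K] by (elim exE)
  show "\<exists>C N. \<forall>\<phi>\<in>test_functions T. closure {t. \<phi> t \<noteq> 0} \<subseteq> K \<longrightarrow>
      (\<forall>B. (\<forall>k\<le>N. \<forall>x. \<bar>(deriv ^^ k) \<phi> x\<bar> \<le> B) \<longrightarrow> \<bar>dist_minus h k \<phi>\<bar> \<le> C * B)"
  proof (rule exI[of _ "C + C'"], rule exI[of _ "max N N'"], intro ballI allI impI)
    fix \<phi> B
    assume \<phi>: "\<phi> \<in> test_functions T" and s: "closure {t. \<phi> t \<noteq> 0} \<subseteq> K"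
      and B: "\<forall>k\<le>max N N'. \<forall>x. \<bar>(deriv ^^ k) \<phi> x\<bar> \<le> B"
    have "\<bar>h \<phi>\<bar> \<le> C * B" by (rule CN[rule_format, OF \<phi> s]) (use B in simp)
    moreover have "\<bar>k \<phi>\<bar> \<le> C' * B" by (rule CN'[rule_format, OF \<phi> s]) (use B in simp)
    ultimately show "\<bar>dist_minus h k \<phi>\<bar> \<le> (C + C') * B"
      by (simp add: dist_minus_def distrib_right)
  qed
qed (simp_all add: dist_minus_def distributions_add[OF h] distributions_add[OF k]
    distributions_scale[OF h] distributions_scale[OF k] right_diff_distrib)

lemma zero_ext_measurable:
  assumes "continuous_on (time_interval T) v"
  shows "zero_ext T v \<in> borel_measurable borel"
proof -
  have "time_interval T = {0..} \<inter> ereal -` {..<T}"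
    by (auto simp: time_interval_def)
  then have "time_interval T \<in> sets borel"
    by simp
  then have "(\<lambda>x. indicator (time_interval T) x *\<^sub>R v x) \<in> borel_measurable borel"
    using assms by (intro borel_measurable_continuous_on_indicator) auto
  also have "(\<lambda>x. indicator (time_interval T) x *\<^sub>R v x) = zero_ext T v"
    by (auto simp: zero_ext_def)
  finally show ?thesis .
qed

lemma compact_below:
  assumes K: "compact K" "K \<subseteq> {t. ereal t < T}" and "t0 \<in> K" "0 \<le> t0"
  obtains b where "0 \<le> b" "ereal b < T" "K \<subseteq> {..b}"
proof -
  obtain b where b: "b \<in> K" "\<forall>t\<in>K. t \<le> b"
    using compact_attains_sup[of K] assms by blast
  with assms show ?thesis by (intro that[of b]) auto
qed

lemma locally_integrableI:
  assumes m: "u \<in> borel_measurable borel"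
    and n: "\<And>t. t \<notin> time_interval T \<Longrightarrow> u t = 0"
    and b: "\<And>b. 0 \<le> b \<Longrightarrow> ereal b < T \<Longrightarrow> \<exists>M. \<forall>t\<in>{0..b}. \<bar>u t\<bar> \<le> M"
  shows "locally_integrable T u"
  unfolding locally_integrable_def
proof (intro allI impI)
  fix K :: "real set"
  assume K: "compact K" "K \<subseteq> {t. ereal t < T}"
  show "set_integrable lborel K u"
  proof (cases "\<exists>t0\<in>K. 0 \<le> t0")
    case False
    then have "(\<lambda>t. indicator K t *\<^sub>R u t) = (\<lambda>_. 0)"
      using n by (intro ext) (auto simp: indicator_def time_interval_def)
    then show ?thesis unfolding set_integrable_def by simp
  next
    case True
    then obtain c where c: "0 \<le> c" "ereal c < T" "K \<subseteq> {..c}"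
      using compact_below[OF K] by blast
    then obtain M where M: "\<And>t. t \<in> {0..c} \<Longrightarrow> \<bar>u t\<bar> \<le> M" using b by blast
    have M': "\<bar>u t\<bar> \<le> \<bar>M\<bar>" if "t \<in> K" for t
    proof (cases "0 \<le> t")
      case True
      then have "t \<in> {0..c}" using that c by auto
      from M[OF this] show ?thesis by linarith
    next
      case False
      then show ?thesis using n[of t] by (simp add: time_interval_def)
    qed
    have Kb: "K \<in> sets lborel" using K(1) by (simp add: borel_compact)
    show ?thesis unfolding set_integrable_def
    proof (rule integrableI_bounded_set_indicator[of _ _ _ "\<bar>M\<bar>"])
      show "u \<in> borel_measurable lborel" using m by simp
      show "emeasure lborel K < \<infinity>"
        using K(1) emeasure_compact_finite by blast
      show "AE t in lborel. t \<in> K \<longrightarrow> norm (u t) \<le> \<bar>M\<bar>" using M' by auto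
    qed (use Kb in auto)
  qed
qed

lemma locally_integrable_zero_ext:
  assumes v: "continuous_on (time_interval T) v"
  shows "locally_integrable T (zero_ext T v)"
proof (rule locally_integrableI)
  show "zero_ext T v \<in> borel_measurable borel" by (rule zero_ext_measurable[OF v])
  show "zero_ext T v t = 0" if "t \<notin> time_interval T" for t using that by (simp add: zero_ext_def)
  fix b assume b: "0 \<le> b" "ereal b < T"
  have s: "{0..b} \<subseteq> time_interval T"
    using b by (auto simp: time_interval_def) (meson ereal_less_eq(3) le_less_trans)
  then have "compact (v ` {0..b})"
    using v by (meson compact_Icc compact_continuous_image continuous_on_subset)
  then obtain M where M: "\<forall>x\<in>v ` {0..b}. norm x \<le> M"
    using bounded_iff[THEN iffD1, OF compact_imp_bounded] by blast
  have "\<bar>zero_ext T v t\<bar> \<le> M" if "t \<in> {0..b}" for t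
  proof -
    have "t \<in> time_interval T" using s that by (rule subsetD)
    then show ?thesis using M that by (simp add: zero_ext_def)
  qed
  then show "\<exists>M. \<forall>t\<in>{0..b}. \<bar>zero_ext T v t\<bar> \<le> M" by blast
qed

lemma integrable_powr_neg:
  fixes \<gamma> b :: real
  assumes "\<gamma> < 1" "0 \<le> b"
  shows "integrable lborel (\<lambda>s. indicator {0<..b} s * s powr (-\<gamma>))"
proof -
  have "(\<lambda>s. s powr (-\<gamma>)) absolutely_integrable_on {0<..b}"
    using assms by (intro nonnegative_absolutely_integrable_1 integrable_on_powr_from_0') auto
  then show ?thesis
    by (simp add: set_integrable_def integrable_completion)
qed

lemma locally_integrable_g_kernel:
  assumes "\<gamma> < 1"
  shows "locally_integrable T (\<lambda>t. c * g_kernel (1 - \<gamma>) t)"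
  unfolding locally_integrable_def
proof (intro allI impI)
  fix K :: "real set"
  assume K: "compact K" "K \<subseteq> {t. ereal t < T}"
  obtain b where b: "\<And>t. t \<in> K \<Longrightarrow> \<bar>t\<bar> \<le> b"
    using compact_imp_bounded[OF K(1)] bounded_iff by (metis real_norm_def)
  have Kb: "K \<in> sets lborel" using K(1) by (simp add: borel_compact)
  have i: "integrable lborel (\<lambda>s. indicator {0<..\<bar>b\<bar>} s * s powr (-\<gamma>))"
    using assms by (rule integrable_powr_neg) simp
  have "integrable lborel (\<lambda>s. c / Gamma (1 - \<gamma>) *
      (indicator K s *\<^sub>R (indicator {0<..\<bar>b\<bar>} s * s powr (-\<gamma>))))"
    using integrable_mult_indicator[OF Kb i] by (rule integrable_mult_right)
  also have "(\<lambda>s. c / Gamma (1 - \<gamma>) *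
      (indicator K s *\<^sub>R (indicator {0<..\<bar>b\<bar>} s * s powr (-\<gamma>)))) =
      (\<lambda>s. indicator K s *\<^sub>R (c * g_kernel (1 - \<gamma>) s))"
    using b by (force simp: g_kernel_def indicator_def)
  finally show "set_integrable lborel K (\<lambda>t. c * g_kernel (1 - \<gamma>) t)"
    by (simp add: set_integrable_def)
qed

lemma locally_integrable_frac_integral:
  assumes v: "continuous_on (time_interval T) v" and \<gamma>: "\<gamma> < 1"
  shows "locally_integrable T
    (zero_ext T (\<lambda>t. c * (LBINT s:{0..t}. (t - s) powr (-\<gamma>) * v s)))"
proof (rule locally_integrableI)
  let ?w = "zero_ext T v"
  let ?I = "\<lambda>t. LBINT s. (if 0 \<le> s \<and> s \<le> t then (t - s) powr (-\<gamma>) * ?w s else 0)"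
  let ?u = "zero_ext T (\<lambda>t. c * (LBINT s:{0..t}. (t - s) powr (-\<gamma>) * v s))"
  have w[measurable]: "?w \<in> borel_measurable borel" by (rule zero_ext_measurable[OF v])
  have eq: "(LBINT s:{0..t}. (t - s) powr (-\<gamma>) * v s) = ?I t" if "t \<in> time_interval T" for t
    unfolding set_lebesgue_integral_def
  proof (rule Bochner_Integration.integral_cong[OF refl])
    fix s
    have "s \<in> time_interval T" if "0 \<le> s" "s \<le> t"
      using that \<open>t \<in> time_interval T\<close>
      by (auto simp: time_interval_def) (meson ereal_less_eq(3) le_less_trans)
    then show "indicator {0..t} s *\<^sub>R ((t - s) powr (-\<gamma>) * v s) =
        (if 0 \<le> s \<and> s \<le> t then (t - s) powr (-\<gamma>) * ?w s else 0)"
      by (auto simp: zero_ext_def)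
  qed
  have I: "?I \<in> borel_measurable borel"
    by measurable
  have "time_interval T = {0..} \<inter> ereal -` {..<T}"
    by (auto simp: time_interval_def)
  then have [measurable]: "time_interval T \<in> sets borel"
    by simp
  have "?u = (\<lambda>t. if t \<in> time_interval T then c * ?I t else 0)"
    using eq by (auto simp: zero_ext_def)
  moreover have "(\<lambda>t. if t \<in> time_interval T then c * ?I t else 0) \<in> borel_measurable borel"
    using I by measurable
  ultimately show "?u \<in> borel_measurable borel" by simp
  show "?u t = 0" if "t \<notin> time_interval T" for t using that by (simp add: zero_ext_def)
  fix b assume b: "0 \<le> b" "ereal b < T"
  have s: "{0..b} \<subseteq> time_interval T"
    using b by (auto simp: time_interval_def) (meson ereal_less_eq(3) le_less_trans)
  then have "compact (v ` {0..b})"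
    using v by (meson compact_Icc compact_continuous_image continuous_on_subset)
  then obtain M where M: "\<forall>x\<in>v ` {0..b}. norm x \<le> M"
    using bounded_iff[THEN iffD1, OF compact_imp_bounded] by blast
  let ?k = "\<lambda>s. indicator {0<..b} s * s powr (-\<gamma>)"
  have k: "integrable lborel ?k" by (rule integrable_powr_neg[OF \<gamma> b(1)])
  have "\<bar>?u t\<bar> \<le> \<bar>c\<bar> * (\<bar>M\<bar> * (LBINT s. ?k s))" if t: "t \<in> {0..b}" for t
  proof -
    have tT: "t \<in> time_interval T" using s t by blast
    have kt: "integrable lborel (\<lambda>s. ?k (t + (-1) * s))"
      by (rule lborel_integrable_real_affine[OF k]) simp
    have le: "\<bar>if 0 \<le> s \<and> s \<le> t then (t - s) powr (-\<gamma>) * ?w s else 0\<bar>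
        \<le> \<bar>M\<bar> * ?k (t + (-1) * s)" for s
    proof (cases "0 \<le> s \<and> s < t")
      case True
      then have "\<bar>?w s\<bar> \<le> \<bar>M\<bar>"
        using M[rule_format, of "v s"] t s True by (auto simp: zero_ext_def)
      moreover have "?k (t + (-1) * s) = (t - s) powr (-\<gamma>)"
        using True t by auto
      ultimately show ?thesis
        using True by (simp add: abs_mult mult.commute mult_right_mono)
    next
      case False
      then show ?thesis by (auto simp: indicator_def)
    qed
    have "norm (?I t) \<le> (LBINT s. \<bar>M\<bar> * ?k (t + (-1) * s))"
    proof (rule Bochner_Integration.integral_norm_bound_integral)
      show i: "integrable lborel (\<lambda>s. \<bar>M\<bar> * ?k (t + (-1) * s))"
        using kt by (rule integrable_mult_right)
      show "integrable lborel (\<lambda>s. if 0 \<le> s \<and> s \<le> t then (t - s) powr (-\<gamma>) * ?w s else 0)"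
      proof (rule Bochner_Integration.integrable_bound[OF i])
        show "(\<lambda>s. if 0 \<le> s \<and> s \<le> t then (t - s) powr (-\<gamma>) * ?w s else 0)
            \<in> borel_measurable lborel"
          by measurable
        show "AE s in lborel. norm (if 0 \<le> s \<and> s \<le> t then (t - s) powr (-\<gamma>) * ?w s else 0)
            \<le> norm (\<bar>M\<bar> * ?k (t + (-1) * s))"
          using le by (intro AE_I2) (metis abs_ge_self order_trans real_norm_def)
      qed
    qed (use le in auto)
    also have "\<dots> = \<bar>M\<bar> * (LBINT s. ?k (t + (-1) * s))" by simp
    also have "(LBINT s. ?k (t + (-1) * s)) = (LBINT s. ?k s)"
      using lborel_integral_real_affine[of "-1" ?k t] by simp
    finally have "\<bar>c * ?I t\<bar> \<le> \<bar>c\<bar> * (\<bar>M\<bar> * (LBINT s. ?k s))"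
      by (simp add: abs_mult mult_left_mono)
    then show ?thesis using tT eq[OF tT] by (simp add: zero_ext_def)
  qed
  then show "\<exists>M. \<forall>t\<in>{0..b}. \<bar>?u t\<bar> \<le> M" by blast
qed

lemma caputo_deriv_in_distributions:
  assumes "continuous_on (time_interval T) v" "\<gamma> < 1"
  shows "caputo_deriv \<gamma> T v \<in> distributions T"
  unfolding caputo_deriv_def frac_deriv_def
  by (rule dist_minus_in_distributions[OF
        dist_deriv_in_distributions[OF
          regular_dist_in_distributions[OF locally_integrable_frac_integral[OF assms]]]
        regular_dist_in_distributions[OF locally_integrable_g_kernel[OF assms(2)]]])

lemma rhs_dist_in_distributions:
  assumes f: "continuous_on ({0..} \<times> UNIV) (\<lambda>(t, x). f t x)"
    and v: "continuous_on (time_interval T) v"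
  shows "rhs_dist f T v \<in> distributions T"
proof -
  have "continuous_on (time_interval T) (\<lambda>t. (t, v t))"
    by (rule continuous_on_Pair[OF continuous_on_id v])
  from continuous_on_compose2[OF f this]
  have "continuous_on (time_interval T) (\<lambda>t. f t (v t))"
    by (auto simp: time_interval_def)
  then show ?thesis
    unfolding rhs_dist_def
    by (rule regular_dist_in_distributions[OF locally_integrable_zero_ext])
qed

end

theory Submission
  imports Defs
begin

text \<open>
  Restrict to times below some \<open>b\<close> smaller than both end points, and put \<open>u = v - v'\<close> and
  \<open>F = f(\<cdot>, v) - f(\<cdot>, v')\<close>, where \<open>v\<close> is meant to stay below \<open>v'\<close>. Testing the differential
  inequality with smoothed indicators of intervals shows that the continuous function
  \<open>W = g\<^bsub>1-\<gamma>\<^esub> * (u - u(0)) - 1 * F\<close> is nonincreasing. Since \<open>W\<close> vanishes for negative times, so is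
  \<open>g\<^bsub>\<gamma>\<^esub> * W\<close>, which equals \<open>1 * (u - u(0) - g\<^bsub>\<gamma>\<^esub> * F)\<close> because \<open>g\<^bsub>\<gamma>\<^esub> * g\<^bsub>1-\<gamma>\<^esub> = 1\<close>. Hence
  \<open>u \<le> u(0) + g\<^bsub>\<gamma>\<^esub> * F\<close>. Monotonicity and the Lipschitz condition give \<open>F \<le> L u\<^sup>+\<close>, so
  \<open>u\<^sup>+ \<le> L g\<^bsub>\<gamma>\<^esub> * u\<^sup>+\<close>, which forces \<open>u\<^sup>+ = 0\<close>.
\<close>

section \<open>Bounded Borel functions as convolution factors\<close>

text \<open>The bound holds everywhere, not just almost everywhere, so that convolution with an
  integrable kernel exists at every point and is again of this kind.\<close>

definition bounded_borel :: "(real \<Rightarrow> real) \<Rightarrow> bool" where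
  "bounded_borel h \<longleftrightarrow> h \<in> borel_measurable borel \<and> (\<exists>M. \<forall>t. \<bar>h t\<bar> \<le> M)"

lemma bounded_borelI:
  "h \<in> borel_measurable borel \<Longrightarrow> (\<And>t. \<bar>h t\<bar> \<le> M) \<Longrightarrow> bounded_borel h"
  by (auto simp: bounded_borel_def)

lemma bounded_borelE:
  assumes "bounded_borel h"
  obtains M where "0 \<le> M" "\<And>t. \<bar>h t\<bar> \<le> M"
  using assms by (auto simp: bounded_borel_def) (meson abs_ge_zero order_trans)

lemma bounded_borel_measurable: "bounded_borel h \<Longrightarrow> h \<in> borel_measurable borel"
  by (simp add: bounded_borel_def)

lemma bounded_borel_shift:
  assumes "bounded_borel h"
  shows "bounded_borel (\<lambda>t. h (t + c))"
proof -
  have [measurable]: "h \<in> borel_measurable borel" by (rule bounded_borel_measurable[OF assms])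
  obtain M where "\<And>t. \<bar>h t\<bar> \<le> M" using bounded_borelE[OF assms] by blast
  then show ?thesis by (intro bounded_borelI[where M = M]) simp_all
qed

lemma bounded_borel_diff:
  assumes "bounded_borel g" "bounded_borel h"
  shows "bounded_borel (\<lambda>t. g t - h t)"
proof -
  obtain M N where "\<And>t. \<bar>g t\<bar> \<le> M" "\<And>t. \<bar>h t\<bar> \<le> N"
    using bounded_borelE[OF assms(1)] bounded_borelE[OF assms(2)] by metis
  then have "\<bar>g t - h t\<bar> \<le> M + N" for t
    by (meson abs_triangle_ineq4 add_mono order_trans)
  then show ?thesis
    using assms by (intro bounded_borelI[where M = "M + N"] borel_measurable_diff) (auto dest: bounded_borel_measurable)
qed

lemma bounded_borel_indicator: "A \<in> sets borel \<Longrightarrow> bounded_borel (indicator A)"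
  by (rule bounded_borelI[where M = 1]) (auto simp: indicator_def)

lemma integrable_bounded_borel_mult:
  fixes f :: "real \<Rightarrow> real"
  assumes f: "integrable lborel f" and h: "bounded_borel h"
  shows "integrable lborel (\<lambda>r. f r * h r)"
proof -
  obtain M where M: "0 \<le> M" "\<And>t. \<bar>h t\<bar> \<le> M" using bounded_borelE[OF h] by blast
  show ?thesis
  proof (rule Bochner_Integration.integrable_bound)
  show "integrable lborel (\<lambda>r. f r * M)" using f by simp
  have [measurable]: "f \<in> borel_measurable borel" using f by simp
  note bounded_borel_measurable[OF h, measurable]
  show "(\<lambda>r. f r * h r) \<in> borel_measurable lborel" by measurable
  show "AE r in lborel. norm (f r * h r) \<le> norm (f r * M)"
    using M by (intro AE_I2) (simp add: abs_mult mult_left_mono)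
  qed
qed

section \<open>Convolution on the real line\<close>

text \<open>The integral runs over the whole line. The usual limits \<open>0\<close> and
  \<open>t\<close> come from the supports of the factors, so commutativity and associativity need no
  bookkeeping of limits.\<close>

definition conv :: "(real \<Rightarrow> real) \<Rightarrow> (real \<Rightarrow> real) \<Rightarrow> real \<Rightarrow> real" where
  "conv f g t = (LBINT r. f r * g (t - r))"

lemma conv_reflect: "conv f g t = (LBINT s. f (t - s) * g s)"
  unfolding conv_def
  by (subst lborel_integral_real_affine[of "-1" _ t]) simp_all

lemma conv_commute: "conv f g = conv g f"
proof
  show "conv f g t = conv g f t" for t
    unfolding conv_reflect[of f] by (simp add: conv_def mult.commute)
qed

lemma integrable_conv:
  assumes f: "integrable lborel f" and h: "bounded_borel h"
  shows "integrable lborel (\<lambda>r. f r * h (t - r))"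
proof (rule integrable_bounded_borel_mult[OF f])
  have [measurable]: "h \<in> borel_measurable borel" by (rule bounded_borel_measurable[OF h])
  obtain M where "\<And>t. \<bar>h t\<bar> \<le> M" using bounded_borelE[OF h] by blast
  then show "bounded_borel (\<lambda>r. h (t - r))" by (intro bounded_borelI[where M = M]) simp_all
qed

lemma conv_diff:
  assumes "integrable lborel f" "bounded_borel g" "bounded_borel h"
  shows "conv f (\<lambda>t. g t - h t) t = conv f g t - conv f h t"
  using integrable_conv[OF assms(1,2)] integrable_conv[OF assms(1,3)]
  by (simp add: conv_def right_diff_distrib)

lemma conv_bounded_borel:
  assumes f: "integrable lborel f" and h: "bounded_borel h"
  shows "bounded_borel (conv f h)"
proof -
  have [measurable]: "f \<in> borel_measurable borel" "h \<in> borel_measurable borel"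
    using f by (simp_all add: bounded_borel_measurable[OF h])
  obtain M where M: "\<And>t. \<bar>h t\<bar> \<le> M" using bounded_borelE[OF h] by blast
  have "norm (conv f h t) \<le> (LBINT r. \<bar>f r\<bar> * M)" for t
    unfolding conv_def
  proof (rule Bochner_Integration.integral_norm_bound_integral)
    show "integrable lborel (\<lambda>r. f r * h (t - r))" by (rule integrable_conv[OF f h])
    show "integrable lborel (\<lambda>r. \<bar>f r\<bar> * M)" using f by simp
    show "norm (f r * h (t - r)) \<le> \<bar>f r\<bar> * M" for r
      using M by (simp add: abs_mult mult_left_mono)
  qed
  then show ?thesis
    by (intro bounded_borelI[where M = "LBINT r. \<bar>f r\<bar> * M"]) (simp_all add: conv_def[abs_def])
qed

text \<open>Dominated convergence. A jump of \<open>h\<close> at \<open>0\<close> is felt only at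
  \<open>r = t\<close>, a null set, so causal functions with a nonzero initial value are
  covered.\<close>

lemma conv_continuous:
  assumes f: "integrable lborel f" and h: "bounded_borel h"
    and c: "\<And>x. x \<noteq> 0 \<Longrightarrow> isCont h x"
  shows "continuous_on UNIV (conv f h)"
proof (intro continuous_at_imp_continuous_on ballI)
  fix t :: real
  have [measurable]: "f \<in> borel_measurable borel" using f by simp
  note bounded_borel_measurable[OF h, measurable]
  obtain M where M: "\<And>t. \<bar>h t\<bar> \<le> M" using bounded_borelE[OF h] by blast
  show "isCont (conv f h) t"
  proof (rule continuous_at_sequentiallyI)
    fix x assume x: "x \<longlonglongrightarrow> t"
    show "(\<lambda>n. conv f h (x n)) \<longlonglongrightarrow> conv f h t"
      unfolding conv_def
    proof (rule integral_dominated_convergence[where w = "\<lambda>r. \<bar>f r\<bar> * M"])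
      show "integrable lborel (\<lambda>r. \<bar>f r\<bar> * M)" using f by simp
      show "AE r in lborel. (\<lambda>n. f r * h (x n - r)) \<longlonglongrightarrow> f r * h (t - r)"
        using AE_lborel_singleton[of t]
      proof eventually_elim
        case (elim r)
        have "isCont h (t - r)" using elim by (intro c) auto
        moreover have "(\<lambda>n. x n - r) \<longlonglongrightarrow> t - r" using x by (intro tendsto_intros)
        ultimately have "(\<lambda>n. h (x n - r)) \<longlonglongrightarrow> h (t - r)"
          by (rule isCont_tendsto_compose)
        then show ?case by (rule tendsto_mult_left)
      qed
      show "AE r in lborel. norm (f r * h (x n - r)) \<le> \<bar>f r\<bar> * M" for n
        using M by (intro AE_I2) (simp add: abs_mult mult_left_mono)
    qed measurable
  qed
qed

text \<open>Fubini. Joint integrability follows from that of \<open>f r * g (s - r)\<close> on the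
  plane together with the bound on \<open>h\<close>.\<close>

lemma conv_assoc:
  assumes f: "integrable lborel f" and g: "integrable lborel g"
    and h: "bounded_borel h"
  shows "conv f (conv g h) t = conv (conv f g) h t"
proof -
  have [measurable]: "f \<in> borel_measurable borel" "g \<in> borel_measurable borel" using f g by simp_all
  note bounded_borel_measurable[OF h, measurable]
  obtain M where M: "\<And>t. \<bar>h t\<bar> \<le> M" using bounded_borelE[OF h] by blast
  have shift: "(LBINT s. G s) = (LBINT s. G (s - r))" for G :: "real \<Rightarrow> real" and r
    using lborel_integral_real_affine[of 1 G "-r"] by simp
  have gi: "integrable lborel (\<lambda>s. g (s - r))" for r
    using lborel_integrable_real_affine[OF g, of 1 "-r"] by simp
  have i0: "integrable (lborel \<Otimes>\<^sub>M lborel) (\<lambda>(r, s). f r * g (s - r))"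
  proof (rule lborel_pair.Fubini_integrable)
    show "(\<lambda>(r, s). f r * g (s - r)) \<in> borel_measurable (lborel \<Otimes>\<^sub>M lborel)" by measurable
    have "(LBINT s. norm (case (r, s) of (r, s) \<Rightarrow> f r * g (s - r))) = \<bar>f r\<bar> * (LBINT s. \<bar>g s\<bar>)" for r
      using shift[of "\<lambda>s. \<bar>g s\<bar>" r] by (simp add: abs_mult)
    then show "integrable lborel (\<lambda>r. LBINT s. norm (case (r, s) of (r, s) \<Rightarrow> f r * g (s - r)))"
      using f by simp
    show "AE r in lborel. integrable lborel (\<lambda>s. case (r, s) of (r, s) \<Rightarrow> f r * g (s - r))"
      using gi by simp
  qed
  have "integrable (lborel \<Otimes>\<^sub>M lborel) (\<lambda>(r, s). f r * g (s - r) * h (t - s))"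
  proof (rule Bochner_Integration.integrable_bound)
    show "integrable (lborel \<Otimes>\<^sub>M lborel) (\<lambda>x. (case x of (r, s) \<Rightarrow> f r * g (s - r)) * M)"
      using i0 by (intro integrable_mult_left)
    show "(\<lambda>(r, s). f r * g (s - r) * h (t - s)) \<in> borel_measurable (lborel \<Otimes>\<^sub>M lborel)"
      by measurable
    have "\<bar>h x\<bar> \<le> \<bar>M\<bar>" for x using M[of x] by linarith
    then show "AE x in lborel \<Otimes>\<^sub>M lborel. norm (case x of (r, s) \<Rightarrow> f r * g (s - r) * h (t - s))
        \<le> norm ((case x of (r, s) \<Rightarrow> f r * g (s - r)) * M)"
      by (intro AE_I2) (auto simp: abs_mult intro!: mult_left_mono)
  qed
  then have "(LBINT s. LBINT r. f r * g (s - r) * h (t - s)) = (LBINT r. LBINT s. f r * g (s - r) * h (t - s))"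
    by (rule lborel_pair.Fubini_integral)
  also have "\<dots> = (LBINT r. f r * conv g h (t - r))"
  proof (rule Bochner_Integration.integral_cong[OF refl])
    fix r
    show "(LBINT s. f r * g (s - r) * h (t - s)) = f r * conv g h (t - r)"
      unfolding conv_def using shift[of "\<lambda>s. g s * h (t - r - s)" r] by (simp add: mult.assoc)
  qed
  finally show ?thesis by (simp add: conv_def)
qed

section \<open>Smooth bumps and the test functions built from them\<close>

text \<open>
  The parameters \<open>p\<close> and \<open>n\<close> make this family closed under differentiation, which is how smoothness
  is proved; \<open>p = 1\<close>, \<open>n = 0\<close> is the usual bump.
\<close>

definition bump :: "real \<Rightarrow> real \<Rightarrow> real poly \<Rightarrow> nat \<Rightarrow> real \<Rightarrow> real" where
  "bump a b p n t = (if a < t \<and> t < b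
     then poly p t / ((t - a) * (b - t)) ^ n * exp (- 1 / ((t - a) * (b - t))) else 0)"

text \<open>The bound \<open>y \<le> exp y\<close> at \<open>y = 1 / (m * w)\<close>, raised to the
  power \<open>m\<close> and inverted: near \<open>w = 0\<close> the exponential beats every
  power.\<close>

lemma exp_neg_inverse_le:
  fixes w :: real
  assumes "0 < w" "0 < m"
  shows "exp (- 1 / w) \<le> (real m * w) ^ m"
proof -
  define y where "y = 1 / (real m * w)"
  have y: "0 < y" using assms by (simp add: y_def)
  have "y ^ m \<le> exp y ^ m"
    using y exp_ge_add_one_self[of y] by (intro power_mono) linarith+
  also have "exp y ^ m = exp (1 / w)"
    using assms by (simp add: exp_of_nat_mult[symmetric] y_def)
  finally have "inverse (exp (1 / w)) \<le> inverse (y ^ m)"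
    using y by (intro le_imp_inverse_le) simp_all
  moreover have "inverse (y ^ m) = (real m * w) ^ m"
    by (simp add: y_def power_one_over inverse_eq_divide)
  ultimately show ?thesis by (simp add: exp_minus)
qed

text \<open>A quadratic bound around each point outside the open interval, end points included,
  forces the derivative there to be \<open>0\<close>. Taking the exponent \<open>n + 2\<close> in
  \<open>exp_neg_inverse_le\<close>, \<open>n\<close> powers of \<open>w\<close> cancel the
  denominator and two remain. An end point lies between \<open>t\<close> and \<open>s\<close>, so
  one factor of \<open>w\<close> is at most \<open>\<bar>t - s\<bar>\<close> and the other at most
  \<open>b - a\<close>.\<close>

lemma bump_quadratic_bound:
  "\<exists>C. \<forall>s t. s \<notin> {a<..<b} \<longrightarrow> \<bar>bump a b p n t\<bar> \<le> C * (t - s)\<^sup>2"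
proof -
  have "bounded (poly p ` {a..b})"
    by (intro compact_imp_bounded compact_continuous_image continuous_intros) simp
  then obtain P where P: "\<And>t. t \<in> {a..b} \<Longrightarrow> \<bar>poly p t\<bar> \<le> P"
    by (metis bounded_iff imageI real_norm_def)
  define C where "C = \<bar>P\<bar> * real (n + 2) ^ (n + 2) * (b - a)\<^sup>2"
  have "\<bar>bump a b p n t\<bar> \<le> C * (t - s)\<^sup>2" if s: "s \<notin> {a<..<b}" for s t
  proof (cases "a < t \<and> t < b")
    case False
    then have "bump a b p n t = 0" by (auto simp: bump_def)
    then show ?thesis by (simp add: C_def)
  next
    case True
    define w where "w = (t - a) * (b - t)"
    have w: "0 < w" using True by (simp add: w_def)
    have "w \<le> (b - a) * \<bar>t - s\<bar>"
    proof (cases "s \<le> a")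
      case True
      have "w \<le> \<bar>t - s\<bar> * (b - a)"
        unfolding w_def using \<open>a < t \<and> t < b\<close> True by (intro mult_mono) auto
      then show ?thesis by (simp add: mult.commute)
    next
      case False
      then show ?thesis
        unfolding w_def using \<open>a < t \<and> t < b\<close> s by (intro mult_mono) auto
    qed
    then have w2: "w\<^sup>2 \<le> (b - a)\<^sup>2 * (t - s)\<^sup>2"
      using w power_mono[of w "(b - a) * \<bar>t - s\<bar>" 2] by (simp add: power_mult_distrib)
    have "\<bar>bump a b p n t\<bar> = \<bar>poly p t\<bar> / w ^ n * exp (- 1 / w)"
      using True w by (simp add: bump_def w_def[symmetric] abs_mult)
    also have "\<dots> \<le> \<bar>P\<bar> / w ^ n * (real (n + 2) * w) ^ (n + 2)"
    proof (intro mult_mono divide_right_mono exp_neg_inverse_le)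
      show "\<bar>poly p t\<bar> \<le> \<bar>P\<bar>" using P[of t] True by auto
    qed (use w in auto)
    also have "\<dots> = \<bar>P\<bar> * real (n + 2) ^ (n + 2) * w\<^sup>2"
      using w by (simp add: power_mult_distrib power_add power2_eq_square del: of_nat_add)
    also have "\<dots> \<le> C * (t - s)\<^sup>2"
      unfolding C_def using w2 by (simp add: mult.assoc mult_left_mono)
    finally show ?thesis .
  qed
  then show ?thesis by blast
qed

text \<open>Inside the interval, \<open>q\<close> is the numerator obtained by putting all terms of
  the product and quotient rules over \<open>w ^ (n + 2)\<close>. Outside, the quadratic bound makes
  the difference quotient tend to \<open>0\<close>.\<close>

lemma bump_has_derivative:
  fixes a b :: real and p :: "real poly" and n :: nat
  defines "w \<equiv> [:-a, 1:] * [:b, -1:]"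
  defines "q \<equiv> pderiv p * w\<^sup>2 - of_nat n * p * pderiv w * w + p * pderiv w"
  shows "(bump a b p n has_real_derivative bump a b q (n + 2) t) (at t)"
proof (cases "t \<in> {a<..<b}")
  case True
  define W where "W = poly w"
  have W: "W s = (s - a) * (b - s)" for s by (simp add: W_def w_def algebra_simps)
  have W0: "W t \<noteq> 0" using True by (simp add: W)
  have dW: "(W has_real_derivative poly (pderiv w) t) (at t)"
    unfolding W_def by (rule poly_DERIV)
  have "((\<lambda>s. poly p s / W s ^ n * exp (- 1 / W s)) has_real_derivative
      bump a b q (n + 2) t) (at t)"
  proof (rule DERIV_cong)
    show "((\<lambda>s. poly p s / W s ^ n * exp (- 1 / W s)) has_real_derivative
      ((poly (pderiv p) t * W t ^ n - poly p t * (real n * (poly (pderiv w) t * W t ^ (n - 1))))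
          / (W t ^ n * W t ^ n)) * exp (- 1 / W t)
        + (exp (- 1 / W t) * (poly (pderiv w) t / (W t * W t))) * (poly p t / W t ^ n)) (at t)"
      using W0 by (auto intro!: derivative_eq_intros dW poly_DERIV) (simp add: field_simps)
    \<comment> \<open>The algebra with opaque letters: \<open>X\<close> stands for \<open>w\<close>,
      \<open>Y\<close> for \<open>w ^ n\<close>, \<open>Z\<close> for \<open>w ^ (n - 1)\<close> and
      \<open>D\<close> for the derivative of \<open>w\<close>, all at \<open>t\<close>. This keeps
      symbolic exponents away from the simplifier.\<close>
    have key: "((P' * Y - P * (N * (D * Z))) / (Y * Y)) * E + (E * (D / (X * X))) * (P / Y)
        = (P' * X\<^sup>2 - N * P * D * X + P * D) / (Y * X\<^sup>2) * E"
      if "X \<noteq> 0" "Y \<noteq> 0" "N * Z = N * Y / X" for P' P X Y Z N D E :: real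
    proof -
      have "N * (D * Z) = D * (N * Y / X)" using that(3) by (simp add: algebra_simps)
      then show ?thesis using that(1,2) by (auto simp: field_simps power2_eq_square)
    qed
    \<comment> \<open>The factor \<open>real n\<close> makes the truncated exponent
      \<open>n - 1\<close> harmless at \<open>n = 0\<close>.\<close>
    have e: "real n * W t ^ (n - 1) = real n * W t ^ n / W t"
      using W0 by (cases n) auto
    have "bump a b q (n + 2) t = poly q t / W t ^ (n + 2) * exp (- 1 / W t)"
      using True by (simp add: bump_def W)
    also have "poly q t = poly (pderiv p) t * (W t)\<^sup>2 - real n * poly p t * poly (pderiv w) t * W t
        + poly p t * poly (pderiv w) t"
      by (simp add: q_def W_def of_nat_poly)
    finally show "((poly (pderiv p) t * W t ^ n - poly p t * (real n * (poly (pderiv w) t * W t ^ (n - 1))))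
          / (W t ^ n * W t ^ n)) * exp (- 1 / W t)
        + (exp (- 1 / W t) * (poly (pderiv w) t / (W t * W t))) * (poly p t / W t ^ n)
        = bump a b q (n + 2) t"
      using key[OF W0 _ e] W0 by (simp add: power_add power2_eq_square)
  qed
  then show ?thesis
    by (rule has_field_derivative_transform_within_open[of _ _ _ "{a<..<b}"])
       (use True in \<open>auto simp: bump_def W\<close>)
next
  case False
  then obtain C where C: "\<And>s. \<bar>bump a b p n s\<bar> \<le> C * (s - t)\<^sup>2"
    using bump_quadratic_bound[of a b p n] by blast
  have z: "bump a b p n t = 0" "bump a b q (n + 2) t = 0" using False by (auto simp: bump_def)
  have "((\<lambda>h. (bump a b p n (t + h) - bump a b p n t) / h) \<longlongrightarrow> 0) (at 0)"
  proof (rule Lim_null_comparison)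
    have "norm ((bump a b p n (t + h) - bump a b p n t) / h) \<le> C * \<bar>h\<bar>" if "h \<noteq> 0" for h
      using C[of "t + h"] that z by (simp add: divide_le_eq power2_eq_square abs_mult mult.assoc)
    then show "\<forall>\<^sub>F h in at 0. norm ((bump a b p n (t + h) - bump a b p n t) / h) \<le> C * \<bar>h\<bar>"
      by (auto simp: eventually_at_filter)
    show "((\<lambda>h. C * \<bar>h\<bar>) \<longlongrightarrow> 0) (at 0)"
      by (auto intro!: tendsto_eq_intros)
  qed
  then show ?thesis unfolding DERIV_def z by simp
qed

text \<open>Uniqueness of derivatives keeps every iterate of \<open>deriv\<close> inside
  \<open>A\<close>, so a class closed under differentiation consists of smooth functions.\<close>

lemma deriv_iterates_differentiable:
  fixes f :: "real \<Rightarrow> real"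
  assumes f: "f \<in> A"
    and A: "\<And>g. g \<in> A \<Longrightarrow> \<exists>g'\<in>A. \<forall>x. (g has_real_derivative g' x) (at x)"
  shows "(deriv ^^ k) f differentiable at x"
proof -
  have "(deriv ^^ k) f \<in> A"
  proof (induction k)
    case (Suc k)
    then obtain g' where g': "g' \<in> A" "\<And>x. ((deriv ^^ k) f has_real_derivative g' x) (at x)"
      using A by blast
    then have "deriv ((deriv ^^ k) f) = g'" by (intro ext DERIV_imp_deriv)
    then show ?case using g' by simp
  qed (simp add: f)
  then show ?thesis using A unfolding real_differentiable_def by blast
qed

lemma bump_continuous: "continuous_on S (bump a b p n)"
  by (intro continuous_at_imp_continuous_on ballI DERIV_isCont[OF bump_has_derivative])

lemma bump_bounded_borel: "bounded_borel (bump a b p n)"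
proof -
  have "bounded (bump a b p n ` {a..b})"
    by (intro compact_imp_bounded compact_continuous_image bump_continuous) simp
  then obtain B where B: "\<And>t. t \<in> {a..b} \<Longrightarrow> \<bar>bump a b p n t\<bar> \<le> B"
    by (metis bounded_iff imageI real_norm_def)
  have "\<bar>bump a b p n t\<bar> \<le> \<bar>B\<bar>" for t
    using B[of t] by (cases "t \<in> {a..b}") (auto simp: bump_def)
  then show ?thesis
    by (intro bounded_borelI borel_measurable_continuous_onI bump_continuous)
qed

lemma bump_measurable [measurable]: "bump a b p n \<in> borel_measurable borel"
  by (rule borel_measurable_continuous_onI) (rule bump_continuous)

lemma bump_integrable: "integrable lborel (bump a b p n)"
proof -
  obtain B where "\<And>t. \<bar>bump a b p n t\<bar> \<le> B" using bounded_borelE[OF bump_bounded_borel] by blast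
  then have "integrable lborel (\<lambda>t. indicator {a..b} t *\<^sub>R bump a b p n t)"
    by (intro integrableI_bounded_set_indicator[of _ _ _ B])
      (auto simp: emeasure_lborel_Icc_eq)
  also have "(\<lambda>t. indicator {a..b} t *\<^sub>R bump a b p n t) = bump a b p n"
    by (auto simp: bump_def indicator_def)
  finally show ?thesis .
qed

text \<open>A window of length \<open>d\<close> smeared by a bump. Its derivative is the difference
  of two translates of the bump, so pairing it with a distributional derivative yields increments
  over \<open>d\<close>, averaged against the bump.\<close>

lemma bump_window_test_function:
  fixes a b d :: real
  assumes d: "0 \<le> d" and T: "ereal (b + d) < T"
  defines "\<rho> \<equiv> bump a b 1 0" and "\<phi> \<equiv> conv (indicator {0<..d}) (bump a b 1 0)"
  shows "\<phi> \<in> test_functions T" and "deriv \<phi> = (\<lambda>t. \<rho> t - \<rho> (t - d))"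
    and "\<And>t. 0 \<le> \<phi> t" and "\<And>t. t \<notin> {a..b + d} \<Longrightarrow> \<phi> t = 0"
proof -
  have \<rho>0: "0 \<le> \<rho> t" for t by (simp add: \<rho>_def bump_def)
  have \<rho>z: "\<rho> t = 0" if "t \<notin> {a<..<b}" for t using that by (auto simp: \<rho>_def bump_def)
  show nn: "0 \<le> \<phi> t" for t
    unfolding \<phi>_def conv_def \<rho>_def[symmetric]
    by (rule Bochner_Integration.integral_nonneg) (simp add: \<rho>0)
  show out: "\<phi> t = 0" if "t \<notin> {a..b + d}" for t
  proof -
    have "(\<lambda>r. indicator {0<..d} r * \<rho> (t - r)) = (\<lambda>_. 0)"
      using that \<rho>z by (force simp: indicator_def)
    then show ?thesis by (simp add: \<phi>_def conv_def \<rho>_def)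
  qed
  \<comment> \<open>A primitive of \<open>\<rho>\<close> turns the convolution into
    \<open>R t - R (t - d)\<close>, which avoids differentiating under the integral sign.\<close>
  obtain R where R: "\<And>x. (R has_real_derivative \<rho> x) (at x)"
  proof -
    have "\<exists>F. \<forall>x. -\<infinity> < ereal x \<longrightarrow> ereal x < \<infinity> \<longrightarrow> (F has_vector_derivative \<rho> x) (at x)"
      by (rule einterval_antiderivative)
         (auto simp: \<rho>_def intro!: DERIV_isCont[OF bump_has_derivative])
    then show ?thesis using that by (auto simp: has_real_derivative_iff_has_vector_derivative)
  qed
  have \<phi>R: "\<phi> t = R t - R (t - d)" for t
  proof -
    have "\<phi> t = (LBINT s. indicator {0<..d} (t - s) * \<rho> s)"
      by (simp add: \<phi>_def \<rho>_def conv_reflect)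
    also have "\<dots> = (LBINT s. indicator {t - d..t} s *\<^sub>R \<rho> s)"
    proof (rule integral_cong_AE)
      show "AE s in lborel. indicator {0<..d} (t - s) * \<rho> s = indicator {t - d..t} s *\<^sub>R \<rho> s"
        using AE_lborel_singleton[of t] by eventually_elim (auto simp: indicator_def)
    qed (simp_all add: \<rho>_def)
    also have "\<dots> = R t - R (t - d)"
      using d R by (intro integral_FTC_atLeastAtMost)
        (auto simp: \<rho>_def bump_continuous has_real_derivative_iff_has_vector_derivative
          intro: has_vector_derivative_at_within)
    finally show ?thesis .
  qed
  have D: "(\<phi> has_real_derivative \<rho> t - \<rho> (t - d)) (at t)" for t
  proof -
    have "((\<lambda>t. R (t - d)) has_real_derivative \<rho> (t - d) * 1) (at t)"
      by (rule DERIV_chain2[OF R]) (auto intro!: derivative_eq_intros)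
    then have "((\<lambda>t. R t - R (t - d)) has_real_derivative \<rho> t - \<rho> (t - d) * 1) (at t)"
      by (intro DERIV_diff R)
    moreover have "\<phi> = (\<lambda>t. R t - R (t - d))" using \<phi>R by blast
    ultimately show ?thesis by simp
  qed
  then show "deriv \<phi> = (\<lambda>t. \<rho> t - \<rho> (t - d))"
    by (intro ext DERIV_imp_deriv)
  \<comment> \<open>Differentiation sends \<open>\<phi>\<close> into the family of differences of
    translated bumps, and that family into itself.\<close>
  define A where "A = insert \<phi> {\<lambda>t. bump a b p n t - bump a b p n (t - d) |p n. True}"
  have smooth: "(deriv ^^ k) \<phi> differentiable at x" for k x
  proof (rule deriv_iterates_differentiable[of _ A])
    show "\<phi> \<in> A" by (simp add: A_def)
    fix g assume "g \<in> A"
    then consider "g = \<phi>" | p n where "g = (\<lambda>t. bump a b p n t - bump a b p n (t - d))"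
      by (auto simp: A_def)
    then show "\<exists>g'\<in>A. \<forall>x. (g has_real_derivative g' x) (at x)"
    proof cases
      case 1
      have "(\<lambda>t. \<rho> t - \<rho> (t - d)) \<in> A" by (auto simp: A_def \<rho>_def)
      then show ?thesis unfolding 1 using D by (intro bexI[of _ "\<lambda>t. \<rho> t - \<rho> (t - d)"] allI)
    next
      case 2
      obtain q where q: "\<And>t. (bump a b p n has_real_derivative bump a b q (n + 2) t) (at t)"
        using bump_has_derivative by blast
      have "((\<lambda>t. bump a b p n (t - d)) has_real_derivative bump a b q (n + 2) (t - d) * 1) (at t)" for t
        by (rule DERIV_chain2[OF q]) (auto intro!: derivative_eq_intros)
      then have "\<forall>t. (g has_real_derivative bump a b q (n + 2) t - bump a b q (n + 2) (t - d)) (at t)"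
        unfolding 2 using q by (auto intro!: DERIV_diff)
      moreover have "(\<lambda>t. bump a b q (n + 2) t - bump a b q (n + 2) (t - d)) \<in> A"
        by (auto simp: A_def)
      ultimately show ?thesis
        by (intro bexI[of _ "\<lambda>t. bump a b q (n + 2) t - bump a b q (n + 2) (t - d)"])
    qed
  qed
  have sub: "closure {t. \<phi> t \<noteq> 0} \<subseteq> {a..b + d}"
    by (rule closure_minimal) (use out in blast, simp)
  then have "compact (closure {t. \<phi> t \<noteq> 0})"
    by (meson bounded_closed_interval bounded_subset closed_closure compact_eq_bounded_closed)
  moreover have "closure {t. \<phi> t \<noteq> 0} \<subseteq> {t. ereal t < T}"
    using sub T by (auto dest!: subsetD) (meson ereal_less_eq(3) le_less_trans)
  ultimately show "\<phi> \<in> test_functions T"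
    using smooth by (auto simp: test_functions_def)
qed

section \<open>Truncated fractional kernels and causal extensions\<close>

text \<open>The cut at \<open>b\<close> makes the kernel integrable on the line. Up to time
  \<open>b\<close> it leaves the convolution with a function vanishing at negative times
  unchanged.\<close>

definition trunc_kernel :: "real \<Rightarrow> real \<Rightarrow> real \<Rightarrow> real" where
  "trunc_kernel \<beta> b r = indicator {0<..b} r * g_kernel \<beta> r"

text \<open>
  Freezing \<open>u\<close> after \<open>b\<close> instead of cutting it off leaves \<open>0\<close> as the only possible discontinuity.
\<close>

definition causal :: "real \<Rightarrow> (real \<Rightarrow> real) \<Rightarrow> real \<Rightarrow> real" where
  "causal b u t = (if t < 0 then 0 else u (min t b))"

lemma trunc_kernel_nonneg: "0 < \<beta> \<Longrightarrow> 0 \<le> trunc_kernel \<beta> b r"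
  by (simp add: trunc_kernel_def g_kernel_def)

lemma trunc_kernel_integrable:
  assumes "0 < \<beta>" "0 \<le> b"
  shows "integrable lborel (trunc_kernel \<beta> b)"
proof -
  have "integrable lborel (\<lambda>s. indicator {0<..b} s * s powr (- (1 - \<beta>)) * (1 / Gamma \<beta>))"
    using assms by (intro integrable_mult_left integrable_powr_neg) auto
  also have "(\<lambda>s. indicator {0<..b} s * s powr (- (1 - \<beta>)) * (1 / Gamma \<beta>)) = trunc_kernel \<beta> b"
    by (auto simp: trunc_kernel_def g_kernel_def indicator_def)
  finally show ?thesis .
qed

context
  fixes b :: real and u :: "real \<Rightarrow> real"
  assumes b: "0 \<le> b" and u: "continuous_on {0..b} u"
begin

lemma clamp_continuous: "continuous_on UNIV (\<lambda>t. u (max 0 (min t b)))"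
  by (rule continuous_on_compose2[OF u]) (use b in \<open>auto intro!: continuous_intros\<close>)

lemma causal_eq: "causal b u = (\<lambda>t. if t < 0 then 0 else u (max 0 (min t b)))"
  using b by (auto simp: causal_def)

lemma causal_bounded_borel: "bounded_borel (causal b u)"
proof -
  have [measurable]: "(\<lambda>t. u (max 0 (min t b))) \<in> borel_measurable borel"
    by (rule borel_measurable_continuous_onI[OF clamp_continuous])
  have "bounded (u ` {0..b})"
    by (intro compact_imp_bounded compact_continuous_image u) simp
  then obtain M where "\<And>t. t \<in> {0..b} \<Longrightarrow> \<bar>u t\<bar> \<le> M"
    by (metis bounded_iff imageI real_norm_def)
  then have M: "\<bar>u (max 0 (min t b))\<bar> \<le> M" for t using b by auto
  have "0 \<le> M" using M[of 0] abs_ge_zero order_trans by blast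
  then show ?thesis unfolding causal_eq
    by (intro bounded_borelI[where M = M]) (use M in \<open>simp_all split: if_splits\<close>)
qed

lemma causal_isCont:
  assumes "x \<noteq> 0 \<or> u 0 = 0"
  shows "isCont (causal b u) x"
proof -
  have c: "isCont (\<lambda>t. u (max 0 (min t b))) y" for y
    using clamp_continuous continuous_on_eq_continuous_at[of UNIV] by auto
  consider "x < 0" | "x > 0" | "x = 0" "u 0 = 0" using assms by linarith
  then show ?thesis
  proof cases
    case 1
    then have "\<forall>\<^sub>F t in nhds x. causal b u t = 0"
      by (intro eventually_mono[OF eventually_nhds_in_open[of "{..<0}" x]]) (auto simp: causal_def)
    then show ?thesis by (simp add: isCont_cong)
  next
    case 2
    then have "\<forall>\<^sub>F t in nhds x. causal b u t = u (max 0 (min t b))"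
      by (intro eventually_mono[OF eventually_nhds_in_open[of "{0<..}" x]]) (auto simp: causal_eq)
    then show ?thesis using c by (simp add: isCont_cong)
  next
    case 3
    then have "causal b u = (\<lambda>t. u (max 0 (min t b)))"
      using b by (auto simp: causal_eq min_def)
    then show ?thesis using c by simp
  qed
qed

end

lemma conv_causal_neg:
  assumes "\<And>r. r \<le> 0 \<Longrightarrow> k r = 0" "t \<le> 0"
  shows "conv k (causal b u) t = 0"
proof -
  have "(\<lambda>r. k r * causal b u (t - r)) = (\<lambda>_. 0)"
    using assms by (fastforce simp: causal_def)
  then show ?thesis by (simp add: conv_def)
qed

text \<open>The integrands agree at every \<open>s\<close>, even at \<open>s = t\<close>, where both
  \<open>0 powr (- \<gamma>)\<close> and the truncated kernel are \<open>0\<close>.\<close>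

lemma frac_integral_eq_conv:
  assumes t: "0 \<le> t" "t \<le> b"
  shows "1 / Gamma (1 - \<gamma>) * (LBINT s:{0..t}. (t - s) powr (- \<gamma>) * v s)
    = conv (trunc_kernel (1 - \<gamma>) b) (causal b v) t"
proof -
  have "1 / Gamma (1 - \<gamma>) * (indicator {0..t} s *\<^sub>R ((t - s) powr (- \<gamma>) * v s))
      = trunc_kernel (1 - \<gamma>) b (t - s) * causal b v s" for s
    using t by (auto simp: trunc_kernel_def g_kernel_def causal_def indicator_def min_def)
  then show ?thesis
    unfolding set_lebesgue_integral_def conv_reflect
    by (simp flip: Bochner_Integration.integral_mult_right_zero)
qed

section \<open>Pairing distributions with windows\<close>

text \<open>For \<open>z \<le> b\<close> the interval from \<open>z - b\<close> to \<open>z\<close>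
  reaches back to time \<open>0\<close> or earlier, and \<open>H\<close> vanishes at negative times.
  Hence up to time \<open>b\<close> convolution with this indicator is a primitive of
  \<open>H\<close>.\<close>

lemma conv_indicator_diff:
  assumes H: "integrable lborel (\<lambda>t. indicator {..b} t * H t)" and H0: "\<And>t. t < 0 \<Longrightarrow> H t = 0"
    and xy: "x \<le> y" "y \<le> b"
  shows "conv (indicator {0..b}) H y - conv (indicator {0..b}) H x
    = (LBINT s. indicator {x<..y} s * H s)"
proof -
  define K where "K t = indicator {..b} t * H t" for t
  have K: "integrable lborel K" using H by (simp add: K_def[abs_def])
  have HK: "conv (indicator {0..b}) H z = (LBINT s. K s * indicator {0..b} (z - s))" if "z \<le> b" for z
    unfolding conv_reflect using that
    by (intro Bochner_Integration.integral_cong refl) (auto simp: indicator_def K_def)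
  have i: "integrable lborel (\<lambda>s. K s * indicator {0..b} (z - s))" for z
    by (intro integrable_conv K bounded_borel_indicator) simp
  have "conv (indicator {0..b}) H y - conv (indicator {0..b}) H x
      = (LBINT s. K s * indicator {0..b} (y - s) - K s * indicator {0..b} (x - s))"
    using xy by (simp add: HK Bochner_Integration.integral_diff[OF i i])
  also have "\<dots> = (LBINT s. indicator {x<..y} s * H s)"
    using xy H0
    by (intro Bochner_Integration.integral_cong refl) (force simp: indicator_def K_def)
  finally show ?thesis .
qed

text \<open>Moving the window from the test function onto \<open>H\<close> produces increments of
  its primitive. The pairing is the value at \<open>0\<close> of a convolution with the reflection
  of \<open>H\<close>, so \<open>conv_assoc\<close> supplies the exchange of integrals. Cutting
  \<open>H\<close> off at \<open>b\<close> is allowed because the window function vanishes beyond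
  \<open>b\<close>.\<close>

lemma integral_mult_window:
  assumes H: "integrable lborel (\<lambda>t. indicator {..b} t * H t)" and H0: "\<And>t. t < 0 \<Longrightarrow> H t = 0"
    and \<rho>: "integrable lborel \<rho>" "bounded_borel \<rho>" and \<rho>0: "\<And>r. b < r + d \<Longrightarrow> \<rho> r = 0"
    and d: "0 \<le> d"
  shows "(LBINT t. H t * conv (indicator {0<..d}) \<rho> t)
    = (LBINT r. \<rho> r * (conv (indicator {0..b}) H (r + d) - conv (indicator {0..b}) H r))"
proof -
  define K where "K t = indicator {..b} t * H t" for t
  have K: "integrable lborel K" using H by (simp add: K_def[abs_def])
  have K': "integrable lborel (\<lambda>t. K (- t))"
    using lborel_integrable_real_affine[OF K, of "-1" 0] by simp
  have reflect: "(LBINT t. G t) = (LBINT t. G (- t))" for G :: "real \<Rightarrow> real"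
    using lborel_integral_real_affine[of "-1" G 0] by simp
  have D: "integrable lborel (indicator {0<..d} :: real \<Rightarrow> real)"
    using d by (intro integrable_real_indicator) (auto simp: emeasure_lborel_Ioc)
  have "H t * conv (indicator {0<..d}) \<rho> t = K t * conv (indicator {0<..d}) \<rho> t" for t
  proof (cases "t \<le> b")
    case False
    then have "(\<lambda>r. indicator {0<..d} r * \<rho> (t - r)) = (\<lambda>_. 0)"
      using \<rho>0 by (intro ext) (auto simp: indicator_def)
    then show ?thesis by (simp add: conv_def)
  qed (simp add: K_def)
  then have "(LBINT t. H t * conv (indicator {0<..d}) \<rho> t)
      = (LBINT t. K t * conv (indicator {0<..d}) \<rho> t)"
    by presburger
  also have "\<dots> = conv (\<lambda>t. K (- t)) (conv (indicator {0<..d}) \<rho>) 0"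
    by (subst reflect) (simp add: conv_def[of "\<lambda>t. K (- t)"])
  also have "\<dots> = conv (conv (\<lambda>t. K (- t)) (indicator {0<..d})) \<rho> 0"
    by (rule conv_assoc[OF K' D \<rho>(2)])
  also have "\<dots> = (LBINT r. \<rho> r * conv (\<lambda>t. K (- t)) (indicator {0<..d}) (- r))"
    by (subst conv_commute) (simp add: conv_def)
  also have "\<dots> = (LBINT r. \<rho> r * (conv (indicator {0..b}) H (r + d) - conv (indicator {0..b}) H r))"
  proof (rule Bochner_Integration.integral_cong[OF refl])
    fix r
    show "\<rho> r * conv (\<lambda>t. K (- t)) (indicator {0<..d}) (- r)
        = \<rho> r * (conv (indicator {0..b}) H (r + d) - conv (indicator {0..b}) H r)"
    proof (cases "r + d \<le> b")
      case False
      then show ?thesis using \<rho>0[of r] by simp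
    next
      case True
      have "conv (indicator {0..b}) H (r + d) - conv (indicator {0..b}) H r
          = (LBINT s. indicator {r<..r + d} s * H s)"
        using True d by (intro conv_indicator_diff H H0) auto
      also have "\<dots> = (LBINT s. K s * indicator {0<..d} (s - r))"
        using True
        by (intro Bochner_Integration.integral_cong refl) (auto simp: indicator_def K_def)
      also have "\<dots> = conv (\<lambda>t. K (- t)) (indicator {0<..d}) (- r)"
        by (subst reflect) (simp add: conv_def minus_diff_commute)
      finally show ?thesis by simp
    qed
  qed
  finally show ?thesis .
qed

text \<open>In the distributional sense \<open>W\<close> is a primitive, before time
  \<open>b\<close>, of the Caputo derivative minus the right-hand side. Subtracting
  \<open>v 0\<close> from \<open>v\<close> accounts for the \<open>g_kernel\<close> term of the
  Caputo derivative.\<close>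

lemma caputo_minus_rhs_window:
  fixes v :: "real \<Rightarrow> real" and f :: "real \<Rightarrow> real \<Rightarrow> real" and a b d e \<gamma> :: real
  assumes v: "continuous_on (time_interval T) v"
    and F: "continuous_on (time_interval T) (\<lambda>t. f t (v t))"
    and \<gamma>: "0 < \<gamma>" "\<gamma> < 1" and b: "0 \<le> b" "ereal b < T" and d: "0 \<le> d" "e + d \<le> b"
  defines "\<rho> \<equiv> bump a e 1 0"
    and "W \<equiv> \<lambda>t. conv (trunc_kernel (1 - \<gamma>) b) (causal b (\<lambda>t. v t - v 0)) t
               - conv (indicator {0..b}) (causal b (\<lambda>t. f t (v t))) t"
  shows "caputo_deriv \<gamma> T v (conv (indicator {0<..d}) \<rho>) - rhs_dist f T v (conv (indicator {0<..d}) \<rho>)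
    = (LBINT r. \<rho> r * (W (r + d) - W r))"
proof -
  define \<phi> where "\<phi> = conv (indicator {0<..d}) \<rho>"
  define k where "k = trunc_kernel (1 - \<gamma>) b"
  define \<theta> :: "real \<Rightarrow> real" where "\<theta> = indicator {0..b}"
  define A where "A = conv k (causal b v)"
  define B where "B = conv \<theta> (causal b (\<lambda>t. f t (v t)))"
  have sub: "{0..b} \<subseteq> time_interval T"
    using b by (auto simp: time_interval_def) (meson ereal_less_eq(3) le_less_trans)
  have vb: "continuous_on {0..b} v" and Fb: "continuous_on {0..b} (\<lambda>t. f t (v t))"
    using continuous_on_subset[OF v sub] continuous_on_subset[OF F sub] by auto
  have edT: "ereal (e + d) < T" using b d by (meson ereal_less_eq(3) le_less_trans)
  have \<phi>': "deriv \<phi> = (\<lambda>t. \<rho> t - \<rho> (t - d))"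
    unfolding \<phi>_def \<rho>_def by (rule bump_window_test_function(2)[OF d(1) edT])
  have \<phi>: "\<phi> t = 0" if "t \<notin> {a..e + d}" for t
    unfolding \<phi>_def \<rho>_def by (rule bump_window_test_function(4)[OF d(1) edT that])
  have \<rho>: "integrable lborel \<rho>" "bounded_borel \<rho>"
    by (simp_all add: \<rho>_def bump_integrable bump_bounded_borel)
  have \<rho>z: "\<rho> t = 0" if "b < t + d" for t using that d by (simp add: \<rho>_def bump_def)
  have k: "integrable lborel k" using \<gamma> b by (simp add: k_def trunc_kernel_integrable)
  have kz: "k r = 0" if "r \<le> 0" for r using that by (simp add: k_def trunc_kernel_def)
  have \<theta>: "integrable lborel \<theta>" "bounded_borel \<theta>"
    unfolding \<theta>_def using b by (auto intro!: integrable_real_indicator bounded_borel_indicator simp: emeasure_lborel_Icc_eq)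
  have cF: "bounded_borel (causal b (\<lambda>t. f t (v t)))" by (rule causal_bounded_borel[OF b(1) Fb])
  have cv: "bounded_borel (causal b v)" by (rule causal_bounded_borel[OF b(1) vb])
  have A: "bounded_borel A" unfolding A_def by (rule conv_bounded_borel[OF k cv])
  have B: "bounded_borel B" unfolding B_def by (rule conv_bounded_borel[OF \<theta>(1) cF])
  have k\<theta>: "bounded_borel (conv \<theta> k)"
    by (subst conv_commute) (rule conv_bounded_borel[OF k \<theta>(2)])
  have shift: "(LBINT t. G t) = (LBINT t. G (t + d))" for G :: "real \<Rightarrow> real"
    using lborel_integral_real_affine[of 1 G d] by (simp add: add.commute)
  note i = integrable_bounded_borel_mult[OF \<rho>(1)]
  \<comment> \<open>Translating one of the two terms of \<open>deriv \<phi>\<close> by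
    \<open>d\<close> and using the minus sign in \<open>dist_deriv\<close> gives increments of
    \<open>A\<close>.\<close>
  have frac: "frac_deriv \<gamma> T v \<phi> = (LBINT r. \<rho> r * (A (r + d) - A r))"
  proof -
    have "zero_ext T (\<lambda>t. 1 / Gamma (1 - \<gamma>) * (LBINT s:{0..t}. (t - s) powr (- \<gamma>) * v s)) t * deriv \<phi> t
        = \<rho> t * A t - \<rho> (t - d) * A t" for t
    proof -
      consider "t < 0" | "t \<in> {0..b}" | "b < t" by fastforce
      then show ?thesis
      proof cases
        case 1
        then have "A t = 0" unfolding A_def by (intro conv_causal_neg kz) auto
        then show ?thesis using 1 by (simp add: zero_ext_def time_interval_def)
      next
        case 2
        then show ?thesis using sub frac_integral_eq_conv[of t b \<gamma> v]
          by (auto simp: zero_ext_def \<phi>' A_def k_def algebra_simps)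
      next
        case 3
        then show ?thesis using d \<rho>z[of t] \<rho>z[of "t - d"] by (simp add: \<phi>')
      qed
    qed
    then have "frac_deriv \<gamma> T v \<phi> = - (LBINT t. \<rho> t * A t - \<rho> (t - d) * A t)"
      by (simp add: frac_deriv_def dist_deriv_def regular_dist_def)
    also have "\<dots> = - ((LBINT t. \<rho> t * A t) - (LBINT t. \<rho> (t - d) * A t))"
    proof (subst Bochner_Integration.integral_diff)
      show "integrable lborel (\<lambda>t. \<rho> (t - d) * A t)"
        using lborel_integrable_real_affine[OF i[OF bounded_borel_shift[OF A, of d]], of 1 "-d"]
        by simp
    qed (simp_all add: i A)
    also have "(LBINT t. \<rho> (t - d) * A t) = (LBINT r. \<rho> r * A (r + d))"
      by (subst shift) simp
    also have "- ((LBINT t. \<rho> t * A t) - (LBINT r. \<rho> r * A (r + d))) = (LBINT r. \<rho> r * (A (r + d) - A r))"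
      by (simp add: right_diff_distrib i A bounded_borel_shift)
    finally show ?thesis .
  qed
  have g: "regular_dist (\<lambda>t. v 0 * g_kernel (1 - \<gamma>) t) \<phi>
      = v 0 * (LBINT r. \<rho> r * (conv \<theta> k (r + d) - conv \<theta> k r))"
  proof -
    have "v 0 * g_kernel (1 - \<gamma>) t * \<phi> t = v 0 * (k t * \<phi> t)" for t
      using \<phi>[of t] d by (cases "t \<le> b") (auto simp: k_def trunc_kernel_def g_kernel_def indicator_def)
    then have "regular_dist (\<lambda>t. v 0 * g_kernel (1 - \<gamma>) t) \<phi> = (LBINT t. v 0 * (k t * \<phi> t))"
      unfolding regular_dist_def by presburger
    also have "\<dots> = v 0 * (LBINT t. k t * \<phi> t)" by simp
    also have "(LBINT t. k t * \<phi> t) = (LBINT r. \<rho> r * (conv \<theta> k (r + d) - conv \<theta> k r))"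
      unfolding \<phi>_def \<theta>_def
    proof (rule integral_mult_window[OF _ _ \<rho> \<rho>z d(1)])
      show "integrable lborel (\<lambda>t. indicator {..b} t * k t)"
        using integrable_mult_indicator[OF _ k, of "{..b}"] by simp
    qed (simp_all add: kz)
    finally show ?thesis .
  qed
  have r: "rhs_dist f T v \<phi> = (LBINT r. \<rho> r * (B (r + d) - B r))"
  proof -
    have "zero_ext T (\<lambda>t. f t (v t)) t * \<phi> t = causal b (\<lambda>t. f t (v t)) t * \<phi> t" for t
      using \<phi>[of t] d sub
      by (cases "t \<le> b") (auto simp: zero_ext_def causal_def time_interval_def subset_iff)
    then have "rhs_dist f T v \<phi> = (LBINT t. causal b (\<lambda>t. f t (v t)) t * \<phi> t)"
      unfolding rhs_dist_def regular_dist_def by presburger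
    also have "\<dots> = (LBINT r. \<rho> r * (B (r + d) - B r))"
      unfolding \<phi>_def B_def \<theta>_def
    proof (rule integral_mult_window[OF _ _ \<rho> \<rho>z d(1)])
      have "indicator {..b} t * causal b (\<lambda>t. f t (v t)) t = \<theta> t * causal b (\<lambda>t. f t (v t)) t" for t
        by (auto simp: causal_def \<theta>_def indicator_def)
      then show "integrable lborel (\<lambda>t. indicator {..b} t * causal b (\<lambda>t. f t (v t)) t)"
        using integrable_bounded_borel_mult[OF \<theta>(1) cF] by presburger
    qed (simp_all add: causal_def)
    finally show ?thesis .
  qed
  \<comment> \<open>The fractional integral of the constant \<open>v 0\<close> is \<open>v 0\<close>
    times the primitive of the kernel. The restriction \<open>x \<le> b\<close> is where the causal
    constant and the truncated \<open>\<theta>\<close> give the same integrand.\<close>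
  have WA: "W x = A x - v 0 * conv \<theta> k x - B x" if "x \<le> b" for x
  proof -
    have c0: "bounded_borel (causal b (\<lambda>_. v 0))" by (rule causal_bounded_borel[OF b(1)]) simp
    have "causal b (\<lambda>t. v t - v 0) = (\<lambda>t. causal b v t - causal b (\<lambda>_. v 0) t)"
      by (auto simp: causal_def)
    then have "conv k (causal b (\<lambda>t. v t - v 0)) x = A x - conv k (causal b (\<lambda>_. v 0)) x"
      using conv_diff[OF k cv c0] by (simp add: A_def)
    moreover have "conv k (causal b (\<lambda>_. v 0)) x = v 0 * conv \<theta> k x"
    proof -
      have "k r * causal b (\<lambda>_. v 0) (x - r) = v 0 * (k r * \<theta> (x - r))" for r
        using that by (cases "r \<le> 0") (auto simp: kz causal_def \<theta>_def indicator_def)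
      then have "conv k (causal b (\<lambda>_. v 0)) x = (LBINT r. v 0 * (k r * \<theta> (x - r)))"
        unfolding conv_def by presburger
      also have "\<dots> = v 0 * conv k \<theta> x" by (simp add: conv_def)
      finally show ?thesis by (simp add: conv_commute[of k])
    qed
    ultimately show ?thesis by (simp add: W_def B_def k_def \<theta>_def)
  qed
  have "(LBINT r. \<rho> r * (W (r + d) - W r)) = (LBINT r. \<rho> r * (A (r + d) - A r)
      - v 0 * (\<rho> r * (conv \<theta> k (r + d) - conv \<theta> k r)) - \<rho> r * (B (r + d) - B r))"
  proof (rule Bochner_Integration.integral_cong[OF refl])
    fix r
    show "\<rho> r * (W (r + d) - W r) = \<rho> r * (A (r + d) - A r)
      - v 0 * (\<rho> r * (conv \<theta> k (r + d) - conv \<theta> k r)) - \<rho> r * (B (r + d) - B r)"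
    proof (cases "b < r + d")
      case True
      then show ?thesis by (simp add: \<rho>z)
    next
      case False
      then show ?thesis using d by (simp add: WA algebra_simps)
    qed
  qed
  also have "\<dots> = (LBINT r. \<rho> r * (A (r + d) - A r))
      - v 0 * (LBINT r. \<rho> r * (conv \<theta> k (r + d) - conv \<theta> k r)) - (LBINT r. \<rho> r * (B (r + d) - B r))"
    by (simp add: i A B k\<theta> bounded_borel_diff bounded_borel_shift)
  finally show ?thesis
    using frac g r by (simp add: caputo_deriv_def dist_minus_def flip: \<phi>_def)
qed

section \<open>From averaged increments to pointwise monotonicity\<close>

text \<open>If the integral vanished, an interval of positive length would be a null set.\<close>

lemma integral_pos_of_pos_on_interval:
  fixes q :: "real \<Rightarrow> real"
  assumes q: "integrable lborel q" "\<And>t. 0 \<le> q t" and pos: "\<And>t. x < t \<Longrightarrow> t < y \<Longrightarrow> 0 < q t"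
    and xy: "x < y"
  shows "0 < (LBINT t. q t)"
proof (rule ccontr)
  assume "\<not> 0 < (LBINT t. q t)"
  then have "(LBINT t. q t) = 0"
    using Bochner_Integration.integral_nonneg[of lborel q] q(2) by (simp add: not_less order_antisym)
  then have "AE t in lborel. q t = 0"
    using q by (subst (asm) integral_nonneg_eq_0_iff_AE) auto
  then have "AE t in lborel. t \<notin> {x<..<y}"
    by eventually_elim (use pos in fastforce)
  then have "{x<..<y} \<in> null_sets lborel"
    by (subst AE_iff_null_sets) auto
  then show False using xy by (auto simp: null_sets_def emeasure_lborel_Ioo)
qed

lemma isCont_pos_nhd:
  fixes g :: "real \<Rightarrow> real"
  assumes "isCont g x" "0 < g x"
  obtains \<delta> where "0 < \<delta>" "\<And>t. \<bar>t - x\<bar> < \<delta> \<Longrightarrow> 0 < g t"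
proof -
  have "\<forall>\<^sub>F t in nhds x. g t \<in> {0<..}"
    using assms by (intro topological_tendstoD) (auto simp: isCont_def tendsto_at_iff_tendsto_nhds)
  then show ?thesis
    using that by (auto simp: eventually_nhds_metric dist_real_def)
qed

text \<open>If \<open>W\<close> had a positive increment from \<open>x\<close> to \<open>y\<close>,
  then by continuity the increment over the same length would stay positive just to the right of
  \<open>x\<close>, and a bump supported there would violate \<open>le\<close>.\<close>

lemma antimono_of_bump_integrals:
  assumes W: "continuous_on UNIV W" "bounded_borel W"
    and le: "\<And>a e d. a < e \<Longrightarrow> 0 \<le> d \<Longrightarrow> e + d \<le> b \<Longrightarrow>
      (LBINT r. bump a e 1 0 r * (W (r + d) - W r)) \<le> 0"
    and xy: "x \<le> y" "y < b"
  shows "W y \<le> W x"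
proof (rule ccontr)
  assume "\<not> W y \<le> W x"
  define d where "d = y - x"
  define g where "g r = W (r + d) - W r" for r
  have "continuous_on UNIV g"
    unfolding g_def by (intro continuous_intros continuous_on_compose2[OF W(1)]) auto
  then have "isCont g x" by (simp add: continuous_on_eq_continuous_at)
  moreover have "0 < g x" using \<open>\<not> W y \<le> W x\<close> by (simp add: g_def d_def)
  ultimately obtain \<delta> where \<delta>: "0 < \<delta>" "\<And>t. \<bar>t - x\<bar> < \<delta> \<Longrightarrow> 0 < g t"
    by (rule isCont_pos_nhd) blast
  \<comment> \<open>The first entry keeps the increment positive, the second gives
    \<open>e + d \<le> b\<close>; the latter exceeds \<open>x\<close> because
    \<open>y < b\<close>.\<close>
  define e where "e = min (x + \<delta>) (b - d)"
  have e: "x < e" using \<delta> xy by (simp add: e_def d_def)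
  have gpos: "0 < g t" if "x < t" "t < e" for t
    using that by (intro \<delta>) (auto simp: e_def)
  have gb: "bounded_borel g"
    unfolding g_def by (intro bounded_borel_diff bounded_borel_shift W)
  have "0 < (LBINT r. bump x e 1 0 r * g r)"
  proof (rule integral_pos_of_pos_on_interval[OF _ _ _ e])
    show "integrable lborel (\<lambda>r. bump x e 1 0 r * g r)"
      by (rule integrable_bounded_borel_mult[OF bump_integrable gb])
    show "0 < bump x e 1 0 r * g r" if "x < r" "r < e" for r
      using that gpos[OF that] by (simp add: bump_def)
    show "0 \<le> bump x e 1 0 r * g r" for r
      using gpos[of r] by (cases "x < r \<and> r < e") (auto simp: bump_def)
  qed
  moreover have "(LBINT r. bump x e 1 0 r * g r) \<le> 0"
    unfolding g_def using xy by (intro le e) (auto simp: d_def e_def)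
  ultimately show False by simp
qed

section \<open>Inverting the fractional integral\<close>

text \<open>The substitution \<open>r = t * x\<close> leads to the integral for
  \<open>Beta \<gamma> (1 - \<gamma>)\<close>, whose value is the product of the two normalising
  Gamma factors. The powers of \<open>t\<close> combine to \<open>1 / t\<close> and cancel the
  Jacobian.\<close>

lemma conv_kernel_kernel:
  assumes \<gamma>: "0 < \<gamma>" "\<gamma> < 1" and t: "0 < t" "t \<le> b"
  shows "conv (trunc_kernel \<gamma> b) (trunc_kernel (1 - \<gamma>) b) t = 1"
proof -
  let ?\<beta> = "\<lambda>x. x powr (\<gamma> - 1) * (1 - x) powr ((1 - \<gamma>) - 1)"
  let ?c = "Gamma \<gamma> * Gamma (1 - \<gamma>)"
  have c: "Gamma \<gamma> \<noteq> 0" "Gamma (1 - \<gamma>) \<noteq> 0"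
    using Gamma_real_pos[of \<gamma>] Gamma_real_pos[of "1 - \<gamma>"] \<gamma> by linarith+
  have "set_integrable lborel {0..1} ?\<beta>" using \<gamma> by (intro integrable_Beta) auto
  then have "(LBINT x:{0..1}. ?\<beta> x) = Beta \<gamma> (1 - \<gamma>)"
    using has_integral_Beta_real[of \<gamma> "1 - \<gamma>"] \<gamma>
    by (simp add: set_borel_integral_eq_integral(2) has_integral_iff)
  also have "\<dots> = ?c" by (simp add: Beta_def)
  finally have B: "(LBINT x. indicator {0..1} x * ?\<beta> x) = ?c"
    by (simp add: set_lebesgue_integral_def)
  have e: "trunc_kernel \<gamma> b (t * x) * trunc_kernel (1 - \<gamma>) b (t - t * x) = indicator {0..1} x * ?\<beta> x / (t * ?c)" for x
  proof (cases "0 < x \<and> x < 1")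
    case True
    have "0 < t * x" "t * x < t" using True t by auto
    moreover from this have "t * x \<le> b" "t - t * x \<le> b" using t by linarith+
    moreover have "t - t * x = t * (1 - x)" by (simp add: algebra_simps)
    moreover have "(t * x) powr (\<gamma> - 1) * (t * (1 - x)) powr (- \<gamma>) = ?\<beta> x / t"
    proof -
      have "t powr (\<gamma> - 1) * t powr (- \<gamma>) = t powr (- 1)"
        unfolding powr_add[symmetric] by simp
      also have "\<dots> = 1 / t" using t by (simp add: powr_neg_one)
      finally have "t powr (\<gamma> - 1) * t powr (- \<gamma>) = 1 / t" .
      moreover have "(t * x) powr (\<gamma> - 1) * (t * (1 - x)) powr (- \<gamma>)
          = (t powr (\<gamma> - 1) * t powr (- \<gamma>)) * ?\<beta> x"
        using True t by (simp add: powr_mult)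
      ultimately show ?thesis by simp
    qed
    ultimately show ?thesis using True t
      by (simp add: trunc_kernel_def g_kernel_def)
  next
    case False
    then have "\<not> (0 < t * x \<and> 0 < t - t * x)"
      using t by (auto simp: zero_less_mult_iff not_less)
    then have "trunc_kernel \<gamma> b (t * x) * trunc_kernel (1 - \<gamma>) b (t - t * x) = 0"
      by (auto simp: trunc_kernel_def indicator_def)
    then show ?thesis using False by (auto simp: indicator_def)
  qed
  have "conv (trunc_kernel \<gamma> b) (trunc_kernel (1 - \<gamma>) b) t
      = t * (LBINT x. trunc_kernel \<gamma> b (t * x) * trunc_kernel (1 - \<gamma>) b (t - t * x))"
    unfolding conv_def using t by (subst lborel_integral_real_affine[of t _ 0]) auto
  also have "\<dots> = 1"
    unfolding e using B c t by simp
  finally show ?thesis .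
qed

text \<open>
  Convolving the nonincreasing function of assumption \<open>anti\<close> with \<open>g\<^bsub>\<gamma>\<^esub>\<close> gives a nonincreasing
  primitive of \<open>w - g\<^bsub>\<gamma>\<^esub> * F\<close>.
\<close>

lemma volterra_inequality:
  assumes \<gamma>: "0 < \<gamma>" "\<gamma> < 1" and b: "0 \<le> b"
    and w: "continuous_on {0..b} w" "w 0 = 0" and F: "continuous_on {0..b} F"
    and anti: "\<And>x y. x \<le> y \<Longrightarrow> y < b \<Longrightarrow>
      conv (trunc_kernel (1 - \<gamma>) b) (causal b w) y - conv (indicator {0..b}) (causal b F) y
      \<le> conv (trunc_kernel (1 - \<gamma>) b) (causal b w) x - conv (indicator {0..b}) (causal b F) x"
    and t: "0 \<le> t" "t < b"
  shows "w t \<le> conv (trunc_kernel \<gamma> b) (causal b F) t"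
proof (rule ccontr)
  assume contr: "\<not> ?thesis"
  define h where "h = trunc_kernel \<gamma> b"
  define k where "k = trunc_kernel (1 - \<gamma>) b"
  define \<theta> :: "real \<Rightarrow> real" where "\<theta> = indicator {0..b}"
  define W where "W t = conv k (causal b w) t - conv \<theta> (causal b F) t" for t
  define q where "q t = causal b w t - conv h (causal b F) t" for t
  have h: "integrable lborel h" and k: "integrable lborel k"
    using \<gamma> b by (simp_all add: h_def k_def trunc_kernel_integrable)
  have h0: "0 \<le> h r" for r using \<gamma> by (simp add: h_def trunc_kernel_nonneg)
  have hz: "h r = 0" and kz: "k r = 0" if "r \<le> 0" for r
    using that by (simp_all add: h_def k_def trunc_kernel_def)
  have \<theta>: "integrable lborel \<theta>" "bounded_borel \<theta>"
    unfolding \<theta>_def using b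
    by (auto intro!: integrable_real_indicator bounded_borel_indicator simp: emeasure_lborel_Icc_eq)
  note cw = causal_bounded_borel[OF b w(1)] and cF = causal_bounded_borel[OF b F]
  have W: "bounded_borel W"
    unfolding W_def by (intro bounded_borel_diff conv_bounded_borel k \<theta> cw cF)
  have q: "bounded_borel q"
    unfolding q_def by (intro bounded_borel_diff conv_bounded_borel h cw cF)
  \<comment> \<open>Here \<open>w 0 = 0\<close> removes the jump of the causal extension at
    \<open>0\<close>.\<close>
  have qc: "isCont q x" for x
  proof -
    have "continuous_on UNIV (conv h (causal b F))"
      using causal_isCont[OF b F] by (intro conv_continuous h cF) auto
    then show ?thesis unfolding q_def
      using causal_isCont[OF b w(1)] w(2) by (intro continuous_diff) (auto simp: continuous_on_eq_continuous_at)
  qed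
  have q0: "q x = 0" if "x < 0" for x
    using that hz by (simp add: q_def conv_causal_neg causal_def)
  have hW: "conv h W x = conv \<theta> q x" if x: "x \<le> b" for x
  proof -
    have "conv h W x = conv h (conv k (causal b w)) x - conv h (conv \<theta> (causal b F)) x"
      unfolding W_def by (intro conv_diff h conv_bounded_borel k \<theta> cw cF)
    also have "conv h (conv \<theta> (causal b F)) x = conv (conv h \<theta>) (causal b F) x"
      by (rule conv_assoc[OF h \<theta>(1) cF])
    also have "\<dots> = conv (conv \<theta> h) (causal b F) x" by (simp add: conv_commute[of h])
    also have "\<dots> = conv \<theta> (conv h (causal b F)) x"
      by (rule conv_assoc[OF \<theta>(1) h cF, symmetric])
    also have "conv h (conv k (causal b w)) x = conv (conv h k) (causal b w) x"
      by (rule conv_assoc[OF h k cw])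
    \<comment> \<open>The kernels convolve to \<open>1\<close> only on \<open>{0<..b}\<close>, which
      suffices: at negative \<open>r\<close> both sides vanish, \<open>0\<close> is a null set, and
      for \<open>r > b\<close> the causal factor is \<open>0\<close> since
      \<open>x \<le> b\<close>.\<close>
    also have "\<dots> = conv \<theta> (causal b w) x"
      unfolding conv_def[of "conv h k"] conv_def[of \<theta>]
    proof (rule integral_cong_AE)
      have [measurable]: "h \<in> borel_measurable borel" "k \<in> borel_measurable borel"
        "\<theta> \<in> borel_measurable borel" "causal b w \<in> borel_measurable borel"
        using h k \<theta> cw by (simp_all add: bounded_borel_measurable)
      have [measurable]: "conv h k \<in> borel_measurable borel" unfolding conv_def[abs_def] by measurable
      show "(\<lambda>r. conv h k r * causal b w (x - r)) \<in> borel_measurable lborel"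
        "(\<lambda>r. \<theta> r * causal b w (x - r)) \<in> borel_measurable lborel" by measurable
      show "AE r in lborel. conv h k r * causal b w (x - r) = \<theta> r * causal b w (x - r)"
        using AE_lborel_singleton[of 0]
      proof eventually_elim
        case (elim r)
        consider "r < 0" | "0 < r" "r \<le> b" | "b < r" using elim by linarith
        then show ?case
        proof cases
          case 1
          have "(\<lambda>s. h s * k (r - s)) = (\<lambda>_. 0)"
          proof
            show "h s * k (r - s) = 0" for s
              using 1 by (cases "s \<le> 0") (auto simp: hz kz)
          qed
          then have "conv h k r = 0" by (simp add: conv_def)
          then show ?thesis using 1 by (simp add: \<theta>_def)
        next
          case 2
          then show ?thesis using conv_kernel_kernel[OF \<gamma>] by (simp add: h_def k_def \<theta>_def)
        next
          case 3
          then show ?thesis using x by (simp add: causal_def)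
        qed
      qed
    qed
    finally show ?thesis
      unfolding q_def using conv_diff[OF \<theta>(1) cw conv_bounded_borel[OF h cF]] by simp
  qed
  have "0 < q t" using contr t by (simp add: q_def h_def causal_def)
  then obtain \<delta> where \<delta>: "0 < \<delta>" "\<And>s. \<bar>s - t\<bar> < \<delta> \<Longrightarrow> 0 < q s"
    using isCont_pos_nhd[OF qc] by blast
  \<comment> \<open>The first entry keeps \<open>q\<close> positive up to and including
    \<open>y\<close>, the second keeps \<open>y\<close> below \<open>b\<close>. The primitive of
    \<open>q\<close> therefore strictly increases from \<open>t\<close> to \<open>y\<close>.\<close>
  define y where "y = min (t + \<delta> / 2) ((t + b) / 2)"
  have y: "t < y" "y < b" using \<delta>(1) t by (auto simp: y_def min_less_iff_disj)
  have qp: "0 < q s" if "t < s" "s \<le> y" for s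
    using that \<delta>(1) by (intro \<delta>) (auto simp: y_def)
  have "indicator {..b} s * q s = \<theta> s * q s" for s
    using q0[of s] by (cases "s < 0") (auto simp: \<theta>_def indicator_def)
  then have "integrable lborel (\<lambda>s. indicator {..b} s * q s)"
    using integrable_bounded_borel_mult[OF \<theta>(1) q] by presburger
  then have "conv \<theta> q y - conv \<theta> q t = (LBINT s. indicator {t<..y} s * q s)"
    unfolding \<theta>_def using y by (intro conv_indicator_diff q0) auto
  also have "0 < \<dots>"
  proof (rule integral_pos_of_pos_on_interval[OF _ _ _ y(1)])
    show "integrable lborel (\<lambda>s. indicator {t<..y} s * q s)"
      using y by (intro integrable_bounded_borel_mult q integrable_real_indicator)
        (auto simp: emeasure_lborel_Ioc)
  qed (use qp in \<open>auto simp: indicator_def less_imp_le\<close>)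
  finally have "conv h W t < conv h W y" using hW y by simp
  \<comment> \<open>A nonnegative kernel preserves monotonicity. It vanishes for
    \<open>r \<le> 0\<close>, so \<open>W\<close> is compared only at times below \<open>b\<close>,
    as \<open>anti\<close> requires.\<close>
  moreover have "conv h W y \<le> conv h W t"
    unfolding conv_def
  proof (rule Bochner_Integration.integral_mono)
    show "h r * W (y - r) \<le> h r * W (t - r)" for r
    proof (cases "r \<le> 0")
      case False
      then have "W (y - r) \<le> W (t - r)"
        unfolding W_def k_def \<theta>_def using y by (intro anti) auto
      then show ?thesis using h0 by (rule mult_left_mono)
    qed (simp add: hz)
  qed (intro integrable_conv h W)+
  ultimately show False by simp
qed

section \<open>A Gronwall inequality for the weakly singular kernel\<close>

text \<open>Dominated convergence with the kernel itself as majorant: the exponential tends to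
  \<open>0\<close> at each \<open>r > 0\<close>, and the kernel vanishes elsewhere.\<close>

lemma trunc_kernel_laplace_tendsto_0:
  assumes "0 < \<beta>" "0 \<le> b"
  shows "(\<lambda>n. LBINT r. trunc_kernel \<beta> b r * exp (- (real n * r))) \<longlonglongrightarrow> 0"
proof -
  note k = trunc_kernel_integrable[OF assms]
  then have [measurable]: "trunc_kernel \<beta> b \<in> borel_measurable borel" by simp
  have "(\<lambda>n. LBINT r. trunc_kernel \<beta> b r * exp (- (real n * r))) \<longlonglongrightarrow> (LBINT r::real. 0)"
  proof (rule integral_dominated_convergence[where w = "trunc_kernel \<beta> b"])
    show "AE r in lborel. (\<lambda>n. trunc_kernel \<beta> b r * exp (- (real n * r))) \<longlonglongrightarrow> 0"
    proof (rule AE_I2)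
      fix r
      show "(\<lambda>n. trunc_kernel \<beta> b r * exp (- (real n * r))) \<longlonglongrightarrow> 0"
      proof (cases "0 < r")
        case True
        then have "(\<lambda>n. exp (- r) ^ n) \<longlonglongrightarrow> 0" by (intro LIMSEQ_realpow_zero) auto
        then have "(\<lambda>n. trunc_kernel \<beta> b r * exp (- r) ^ n) \<longlonglongrightarrow> 0"
          by (rule tendsto_mult_right_zero)
        then show ?thesis by (simp flip: exp_of_nat_mult)
      qed (simp add: trunc_kernel_def)
    qed
    show "AE r in lborel. norm (trunc_kernel \<beta> b r * exp (- (real n * r))) \<le> trunc_kernel \<beta> b r" for n
    proof (rule AE_I2)
      fix r
      show "norm (trunc_kernel \<beta> b r * exp (- (real n * r))) \<le> trunc_kernel \<beta> b r"
      proof (cases "0 < r")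
        case True
        then have "trunc_kernel \<beta> b r * exp (- (real n * r)) \<le> trunc_kernel \<beta> b r"
          by (intro mult_left_le trunc_kernel_nonneg assms) simp
        then show ?thesis using trunc_kernel_nonneg[OF assms(1), of b r] by simp
      qed (simp add: trunc_kernel_def)
    qed
  qed (use k in simp_all)
  then show ?thesis by simp
qed

text \<open>
  In the weighted norm \<open>sup e\<^bsup>-nt\<^esup> \<bar>p(t)\<bar>\<close> convolution with \<open>g\<^bsub>\<beta>\<^esub>\<close> has norm at most the Laplace
  transform of the kernel at \<open>n\<close>, which tends to \<open>0\<close>.
\<close>

lemma trunc_kernel_gronwall:
  assumes \<beta>: "0 < \<beta>" and b: "0 \<le> b" and L: "0 \<le> L"
    and p: "continuous_on {0..b} p" "\<And>t. t \<in> {0..b} \<Longrightarrow> 0 \<le> p t"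
    and le: "\<And>t. 0 \<le> t \<Longrightarrow> t < b \<Longrightarrow> p t \<le> L * conv (trunc_kernel \<beta> b) (causal b p) t"
    and t: "0 \<le> t" "t < b"
  shows "p t \<le> 0"
proof -
  define h where "h = trunc_kernel \<beta> b"
  define I where "I n = (LBINT r. h r * exp (- (real n * r)))" for n
  have h: "integrable lborel h" using \<beta> b by (simp add: h_def trunc_kernel_integrable)
  have h0: "0 \<le> h r" for r using \<beta> by (simp add: h_def trunc_kernel_nonneg)
  have "(\<lambda>n. L * I n) \<longlonglongrightarrow> 0"
    unfolding I_def h_def by (intro tendsto_mult_right_zero trunc_kernel_laplace_tendsto_0 \<beta> b)
  then have "\<forall>\<^sub>F n in sequentially. L * I n < 1"
    by (rule order_tendstoD) simp
  then obtain n where n: "L * I n < 1" by (auto simp: eventually_sequentially)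
  have "continuous_on {0..t} (\<lambda>s. exp (- (real n * s)) * p s)"
    using t by (intro continuous_intros continuous_on_subset[OF p(1)]) auto
  \<comment> \<open>The maximum is taken over \<open>{0..t}\<close> and not over
    \<open>{0..b}\<close>, since \<open>le\<close> is available only strictly before
    \<open>b\<close>.\<close>
  then obtain s where s: "s \<in> {0..t}"
    and smax: "\<And>r. r \<in> {0..t} \<Longrightarrow> exp (- (real n * r)) * p r \<le> exp (- (real n * s)) * p s"
    using continuous_attains_sup[of "{0..t}" "\<lambda>s. exp (- (real n * s)) * p s"] t by auto
  define N where "N = exp (- (real n * s)) * p s"
  have N0: "0 \<le> N" using s t p(2)[of s] by (simp add: N_def)
  have pN: "p r \<le> N * exp (real n * r)" if "r \<in> {0..t}" for r
  proof -
    have "exp (- (real n * r)) * p r * exp (real n * r) \<le> N * exp (real n * r)"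
      using smax[OF that] by (simp add: N_def)
    moreover have "exp (- (real n * r)) * p r * exp (real n * r) = p r"
      by (simp add: exp_minus)
    ultimately show ?thesis by simp
  qed
  have i: "integrable lborel (\<lambda>r. h r * exp (- (real n * r)))"
  proof (rule Bochner_Integration.integrable_bound[OF h])
    have [measurable]: "h \<in> borel_measurable borel" using h by simp
    show "(\<lambda>r. h r * exp (- (real n * r))) \<in> borel_measurable lborel" by measurable
    show "AE r in lborel. norm (h r * exp (- (real n * r))) \<le> norm (h r)"
    proof (rule AE_I2)
      show "norm (h r * exp (- (real n * r))) \<le> norm (h r)" for r
        by (cases "0 < r") (auto simp: h_def trunc_kernel_def abs_mult intro!: mult_left_le)
    qed
  qed
  have "conv h (causal b p) s \<le> (LBINT r. (N * exp (real n * s)) * (h r * exp (- (real n * r))))"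
    unfolding conv_def
  proof (rule Bochner_Integration.integral_mono)
    show "integrable lborel (\<lambda>r. h r * causal b p (s - r))"
      by (intro integrable_conv h causal_bounded_borel b p(1))
    show "integrable lborel (\<lambda>r. (N * exp (real n * s)) * (h r * exp (- (real n * r))))"
      using i by (rule integrable_mult_right)
    fix r
    have "h r * causal b p (s - r) \<le> h r * (N * exp (real n * (s - r)))"
    proof (cases "0 < r \<and> r \<le> s")
      case True
      then have "causal b p (s - r) \<le> N * exp (real n * (s - r))"
        using pN[of "s - r"] s t by (simp add: causal_def min_def)
      then show ?thesis using h0 by (rule mult_left_mono)
    next
      case False
      then show ?thesis using N0 h0[of r]
        by (cases "0 < r") (auto simp: causal_def h_def trunc_kernel_def intro!: mult_nonneg_nonneg)
    qed
    then show "h r * causal b p (s - r) \<le> (N * exp (real n * s)) * (h r * exp (- (real n * r)))"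
      by (simp add: right_diff_distrib exp_diff exp_minus field_simps)
  qed
  also have "\<dots> = N * exp (real n * s) * I n" by (simp add: I_def)
  finally have "p s \<le> L * (N * exp (real n * s) * I n)"
    using le[of s] s t L by (simp add: h_def) (meson mult_left_mono order_trans)
  then have "exp (- (real n * s)) * p s \<le> exp (- (real n * s)) * (L * (N * exp (real n * s) * I n))"
    by (intro mult_left_mono) auto
  moreover have "exp (- (real n * s)) * (L * (N * exp (real n * s) * I n)) = N * (L * I n)"
    by (simp add: exp_minus)
  ultimately have "N \<le> N * (L * I n)" unfolding N_def[symmetric] by linarith
  then have "N = 0"
    using N0 n by (metis less_eq_real_def mult.right_neutral mult_less_cancel_left_pos not_le)
  then show ?thesis using pN[of t] t by simp
qed

section \<open>The comparison principle\<close>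

text \<open>Hypothesis \<open>le\<close> treats both functions as inexact, so the two halves of the
  theorem differ only in which of them is the solution. It is tested only on functions admissible
  for both intervals.\<close>

lemma caputo_comparison:
  fixes f :: "real \<Rightarrow> real \<Rightarrow> real" and \<gamma> :: real
  assumes f: "continuous_on ({0..} \<times> UNIV) (\<lambda>(t, x). f t x)" "local_lipschitz {0..} UNIV f"
      "\<And>t x y. 0 \<le> t \<Longrightarrow> x \<le> y \<Longrightarrow> f t x \<le> f t y"
    and \<gamma>: "0 < \<gamma>" "\<gamma> < 1"
    and v: "continuous_on (time_interval T) v" and u: "continuous_on (time_interval S) u"
    and le: "\<And>\<phi>. \<phi> \<in> test_functions T \<Longrightarrow> \<phi> \<in> test_functions S \<Longrightarrow> (\<And>t. 0 \<le> \<phi> t) \<Longrightarrow>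
      caputo_deriv \<gamma> T v \<phi> - rhs_dist f T v \<phi> \<le> caputo_deriv \<gamma> S u \<phi> - rhs_dist f S u \<phi>"
    and vu0: "v 0 \<le> u 0" and t: "t \<in> time_interval T" "t \<in> time_interval S"
  shows "v t \<le> u t"
proof -
  have t0: "0 \<le> t" using t by (simp add: time_interval_def)
  obtain b where tb: "t < b" and bT: "ereal b < T" and bS: "ereal b < S"
  proof -
    have "ereal t < min T S" using t by (simp add: time_interval_def)
    then obtain b where "ereal t < ereal b" "ereal b < min T S" using ereal_dense2 by blast
    then show ?thesis using that by auto
  qed
  have b: "0 \<le> b" using t0 tb by simp
  have compose: "continuous_on A (\<lambda>s. f s (z s))" if "A \<subseteq> {0..}" "continuous_on A z" for A z
    using continuous_on_compose2[OF f(1) continuous_on_Pair[OF continuous_on_id that(2)]] that(1)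
    by auto
  have Fv: "continuous_on (time_interval T) (\<lambda>s. f s (v s))"
    and Fu: "continuous_on (time_interval S) (\<lambda>s. f s (u s))"
    by (rule compose[OF _ v], force simp: time_interval_def)
       (rule compose[OF _ u], force simp: time_interval_def)
  have "{0..b} \<subseteq> time_interval T" "{0..b} \<subseteq> time_interval S"
    using bT bS by (auto simp: time_interval_def) (meson ereal_less_eq(3) le_less_trans)+
  then have vb: "continuous_on {0..b} v" and ub: "continuous_on {0..b} u"
    using v u continuous_on_subset by blast+
  have Fvb: "continuous_on {0..b} (\<lambda>s. f s (v s))" and Fub: "continuous_on {0..b} (\<lambda>s. f s (u s))"
    by (auto intro!: compose vb ub)
  define k where "k = trunc_kernel (1 - \<gamma>) b"
  define \<theta> :: "real \<Rightarrow> real" where "\<theta> = indicator {0..b}"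
  define F where "F s = f s (v s) - f s (u s)" for s
  define w where "w s = (v s - v 0) - (u s - u 0)" for s
  define p where "p s = max 0 (v s - u s)" for s
  define V where "V = (\<lambda>t. conv k (causal b (\<lambda>t. v t - v 0)) t - conv \<theta> (causal b (\<lambda>t. f t (v t))) t)"
  define U where "U = (\<lambda>t. conv k (causal b (\<lambda>t. u t - u 0)) t - conv \<theta> (causal b (\<lambda>t. f t (u t))) t)"
  define W where "W = (\<lambda>t. conv k (causal b w) t - conv \<theta> (causal b F) t)"
  have k: "integrable lborel k" using \<gamma> b by (simp add: k_def trunc_kernel_integrable)
  have \<theta>: "integrable lborel \<theta>"
    unfolding \<theta>_def using b by (auto intro!: integrable_real_indicator simp: emeasure_lborel_Icc_eq)
  have wb: "continuous_on {0..b} w" and Fb: "continuous_on {0..b} F" and pb: "continuous_on {0..b} p"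
    unfolding w_def F_def p_def by (intro continuous_intros vb ub Fvb Fub)+
  have cv: "bounded_borel (causal b (\<lambda>t. v t - v 0))" and cu: "bounded_borel (causal b (\<lambda>t. u t - u 0))"
    by (intro causal_bounded_borel b continuous_intros vb ub)+
  note cFv = causal_bounded_borel[OF b Fvb] and cFu = causal_bounded_borel[OF b Fub]
    and cw = causal_bounded_borel[OF b wb] and cF = causal_bounded_borel[OF b Fb]
    and cp = causal_bounded_borel[OF b pb]
  have WVU: "W x = V x - U x" for x
  proof -
    have "causal b w = (\<lambda>t. causal b (\<lambda>t. v t - v 0) t - causal b (\<lambda>t. u t - u 0) t)"
      "causal b F = (\<lambda>t. causal b (\<lambda>t. f t (v t)) t - causal b (\<lambda>t. f t (u t)) t)"
      by (auto simp: causal_def w_def F_def)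
    then show ?thesis
      using conv_diff[OF k cv cu] conv_diff[OF \<theta> cFv cFu] by (simp add: W_def V_def U_def)
  qed
  have Vb: "bounded_borel V" and Ub: "bounded_borel U" and Wb: "bounded_borel W"
    unfolding V_def U_def W_def
    by (intro bounded_borel_diff conv_bounded_borel k \<theta> cv cu cFv cFu cw cF)+
  have Wc: "continuous_on UNIV W"
    unfolding W_def
    by (intro continuous_on_diff conv_continuous k \<theta> cw cF causal_isCont[OF b wb] causal_isCont[OF b Fb]) auto
  have anti: "W y \<le> W x" if "x \<le> y" "y < b" for x y
  proof (rule antimono_of_bump_integrals[OF Wc Wb _ that])
    fix a e d :: real
    assume aed: "a < e" "0 \<le> d" "e + d \<le> b"
    define \<phi> where "\<phi> = conv (indicator {0<..d}) (bump a e 1 0)"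
    have "ereal (e + d) < T" "ereal (e + d) < S"
      using aed bT bS by (meson ereal_less_eq(3) le_less_trans)+
    then have "\<phi> \<in> test_functions T" "\<phi> \<in> test_functions S" "\<And>t. 0 \<le> \<phi> t"
      unfolding \<phi>_def using aed(2) by (auto intro: bump_window_test_function)
    then have "caputo_deriv \<gamma> T v \<phi> - rhs_dist f T v \<phi> \<le> caputo_deriv \<gamma> S u \<phi> - rhs_dist f S u \<phi>"
      by (rule le)
    then have "(LBINT r. bump a e 1 0 r * (V (r + d) - V r)) \<le> (LBINT r. bump a e 1 0 r * (U (r + d) - U r))"
      unfolding \<phi>_def V_def U_def k_def \<theta>_def
      by (simp only: caputo_minus_rhs_window[where f = f, OF v Fv \<gamma> b bT aed(2,3)]
          caputo_minus_rhs_window[where f = f, OF u Fu \<gamma> b bS aed(2,3)])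
    moreover have "(LBINT r. bump a e 1 0 r * (W (r + d) - W r))
        = (LBINT r. bump a e 1 0 r * (V (r + d) - V r)) - (LBINT r. bump a e 1 0 r * (U (r + d) - U r))"
    proof (subst Bochner_Integration.integral_diff[symmetric])
      show "integrable lborel (\<lambda>r. bump a e 1 0 r * (V (r + d) - V r))"
        "integrable lborel (\<lambda>r. bump a e 1 0 r * (U (r + d) - U r))"
        by (intro integrable_bounded_borel_mult bump_integrable bounded_borel_diff bounded_borel_shift Vb Ub)+
    qed (simp add: WVU algebra_simps)
    ultimately show "(LBINT r. bump a e 1 0 r * (W (r + d) - W r)) \<le> 0" by simp
  qed
  have volterra: "w s \<le> conv (trunc_kernel \<gamma> b) (causal b F) s" if "0 \<le> s" "s < b" for s
    using anti unfolding W_def k_def \<theta>_def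
    by (intro volterra_inequality[OF \<gamma> b wb _ Fb _ that]) (auto simp: w_def)
  \<comment> \<open>The local Lipschitz condition becomes uniform on a compact set containing both
    graphs. Where \<open>v s \<le> u s\<close>, monotonicity already gives
    \<open>F s \<le> 0\<close>, so only the positive part \<open>p\<close> enters.\<close>
  obtain L where L0: "0 \<le> L" and L: "\<And>s. s \<in> {0..b} \<Longrightarrow> F s \<le> L * p s"
  proof -
    have "bounded (v ` {0..b} \<union> u ` {0..b})"
      by (intro bounded_Un[THEN iffD2] conjI compact_imp_bounded compact_continuous_image vb ub) auto
    then obtain R where R: "\<And>x. x \<in> v ` {0..b} \<union> u ` {0..b} \<Longrightarrow> norm x \<le> R"
      unfolding bounded_iff by blast
    have "local_lipschitz {0..b} (cball 0 R) f"
      by (rule local_lipschitz_subset[OF f(2)]) auto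
    moreover have "continuous_on {0..b} (\<lambda>s. f s x)" for x
      by (rule compose) auto
    ultimately obtain L where L: "\<And>s. s \<in> {0..b} \<Longrightarrow> L-lipschitz_on (cball 0 R) (f s)"
      using local_lipschitz_compact_implies_lipschitz[of "{0..b}" "cball 0 R" f] by auto
    have L0: "0 \<le> L" using L[of 0] b lipschitz_on_nonneg by auto
    have "F s \<le> L * p s" if s: "s \<in> {0..b}" for s
    proof (cases "v s \<le> u s")
      case True
      then have "F s \<le> 0" using f(3)[of s "v s" "u s"] s by (simp add: F_def)
      then show ?thesis using L0 True by (simp add: p_def)
    next
      case False
      have "dist (f s (v s)) (f s (u s)) \<le> L * dist (v s) (u s)"
        using s R by (intro lipschitz_onD[OF L[OF s]]) auto
      then show ?thesis using False by (simp add: F_def p_def dist_real_def)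
    qed
    then show ?thesis using L0 that by blast
  qed
  have "p t \<le> 0"
  proof (rule trunc_kernel_gronwall[OF \<gamma>(1) b L0 pb _ _ t0 tb])
    show "0 \<le> p s" for s by (simp add: p_def)
    fix s :: real assume s: "0 \<le> s" "s < b"
    let ?h = "trunc_kernel \<gamma> b"
    have h: "integrable lborel ?h" by (rule trunc_kernel_integrable[OF \<gamma>(1) b])
    have "conv ?h (causal b F) s \<le> (LBINT r. L * (?h r * causal b p (s - r)))"
      unfolding conv_def
    proof (rule Bochner_Integration.integral_mono)
      show "integrable lborel (\<lambda>r. L * (?h r * causal b p (s - r)))"
        by (intro integrable_mult_right integrable_conv h cp)
      fix r
      have "causal b F (s - r) \<le> L * causal b p (s - r)"
        using L b by (simp add: causal_def)
      then have "?h r * causal b F (s - r) \<le> ?h r * (L * causal b p (s - r))"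
        by (intro mult_left_mono trunc_kernel_nonneg \<gamma>)
      then show "?h r * causal b F (s - r) \<le> L * (?h r * causal b p (s - r))"
        by (simp add: mult.left_commute)
    qed (intro integrable_conv h cF)
    also have "\<dots> = L * conv ?h (causal b p) s" by (simp add: conv_def)
    finally have le1: "w s \<le> L * conv ?h (causal b p) s" using volterra[OF s] by simp
    have "0 \<le> conv ?h (causal b p) s"
      unfolding conv_def
      by (intro Bochner_Integration.integral_nonneg mult_nonneg_nonneg trunc_kernel_nonneg \<gamma>)
         (simp add: causal_def p_def)
    then have "0 \<le> L * conv ?h (causal b p) s" using L0 by simp
    \<comment> \<open>The difference \<open>v s - u s\<close> is \<open>w s\<close> plus the
      nonpositive number \<open>v 0 - u 0\<close>. As the bound is also nonnegative, it passes to
      the positive part.\<close>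
    then show "p s \<le> L * conv ?h (causal b p) s"
      using le1 vu0 by (simp add: p_def w_def)
  qed
  then show ?thesis by (simp add: p_def)
qed

theorem theorem4p10:
  fixes f :: "real \<Rightarrow> real \<Rightarrow> real" and \<gamma> :: real
  assumes f_cont: "continuous_on ({0..} \<times> UNIV) (\<lambda>(t, x). f t x)"
    and f_lipschitz: "local_lipschitz {0..} UNIV f"
    and f_mono: "\<And>t x y. 0 \<le> t \<Longrightarrow> x \<le> y \<Longrightarrow> f t x \<le> f t y"
    and \<gamma>: "0 < \<gamma>" "\<gamma> < 1"
  shows
    "(\<forall>T\<^sub>1 T\<^sub>2 v\<^sub>1 v\<^sub>2.
        0 < T\<^sub>1 \<and> 0 < T\<^sub>2
        \<and> continuous_on (time_interval T\<^sub>1) v\<^sub>1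
        \<and> nonpositive_dist T\<^sub>1 (dist_minus (caputo_deriv \<gamma> T\<^sub>1 v\<^sub>1) (rhs_dist f T\<^sub>1 v\<^sub>1))
        \<and> continuous_solution f \<gamma> T\<^sub>2 v\<^sub>2
        \<and> v\<^sub>2 0 \<ge> v\<^sub>1 0
        \<longrightarrow> (\<forall>t \<in> time_interval T\<^sub>1 \<inter> time_interval T\<^sub>2. v\<^sub>1 t \<le> v\<^sub>2 t))
     \<and> (\<forall>T\<^sub>1 T\<^sub>2 v\<^sub>1 v\<^sub>2.
        0 < T\<^sub>1 \<and> 0 < T\<^sub>2
        \<and> continuous_on (time_interval T\<^sub>1) v\<^sub>1
        \<and> nonpositive_dist T\<^sub>1 (dist_minus (rhs_dist f T\<^sub>1 v\<^sub>1) (caputo_deriv \<gamma> T\<^sub>1 v\<^sub>1))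
        \<and> continuous_solution f \<gamma> T\<^sub>2 v\<^sub>2
        \<and> v\<^sub>2 0 \<le> v\<^sub>1 0
        \<longrightarrow> (\<forall>t \<in> time_interval T\<^sub>1 \<inter> time_interval T\<^sub>2. v\<^sub>1 t \<ge> v\<^sub>2 t))"
proof (intro conjI allI impI ballI; elim conjE IntE)
  fix T\<^sub>1 T\<^sub>2 v\<^sub>1 v\<^sub>2 t
  assume v1: "continuous_on (time_interval T\<^sub>1) v\<^sub>1" and v2: "continuous_solution f \<gamma> T\<^sub>2 v\<^sub>2"
    and np: "nonpositive_dist T\<^sub>1 (dist_minus (caputo_deriv \<gamma> T\<^sub>1 v\<^sub>1) (rhs_dist f T\<^sub>1 v\<^sub>1))"
    and init: "v\<^sub>1 0 \<le> v\<^sub>2 0" and t: "t \<in> time_interval T\<^sub>1" "t \<in> time_interval T\<^sub>2"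
  have v2c: "continuous_on (time_interval T\<^sub>2) v\<^sub>2"
    using v2 by (simp add: continuous_solution_def)
  show "v\<^sub>1 t \<le> v\<^sub>2 t"
    \<comment> \<open>The upper side of the required inequality is \<open>0\<close> on test
      functions because \<open>v\<^sub>2\<close> solves the equation.\<close>
    by (rule caputo_comparison[OF f_cont f_lipschitz f_mono \<gamma> v1 v2c _ init t])
       (use np v2 in \<open>auto simp: nonpositive_dist_def dist_minus_def continuous_solution_def dist_eq_def\<close>)
next
  fix T\<^sub>1 T\<^sub>2 v\<^sub>1 v\<^sub>2 t
  assume v1: "continuous_on (time_interval T\<^sub>1) v\<^sub>1" and v2: "continuous_solution f \<gamma> T\<^sub>2 v\<^sub>2"
    and np: "nonpositive_dist T\<^sub>1 (dist_minus (rhs_dist f T\<^sub>1 v\<^sub>1) (caputo_deriv \<gamma> T\<^sub>1 v\<^sub>1))"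
    and init: "v\<^sub>2 0 \<le> v\<^sub>1 0" and t: "t \<in> time_interval T\<^sub>1" "t \<in> time_interval T\<^sub>2"
  have v2c: "continuous_on (time_interval T\<^sub>2) v\<^sub>2"
    using v2 by (simp add: continuous_solution_def)
  show "v\<^sub>2 t \<le> v\<^sub>1 t"
    \<comment> \<open>Now the solution \<open>v\<^sub>2\<close> is the lower function, so the roles
      of the two intervals are exchanged and the lower side is \<open>0\<close>.\<close>
    by (rule caputo_comparison[OF f_cont f_lipschitz f_mono \<gamma> v2c v1 _ init t(2,1)])
       (use np v2 in \<open>auto simp: nonpositive_dist_def dist_minus_def continuous_solution_def dist_eq_def\<close>)
qed

end
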